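(* Let $s\in(0,1)$ and $n\in\mathbb{N}\cup\{0\}$, let $C^{(s+1/2)}_n$ denote the Gegenbauer polynomial of degree $n$ with parameter $s+1/2$, and let $p_n(x)=C^{(s+1/2)}_n(2x-1)$. Then the weighted operator $(-\Delta)^s_\omega$ in the interval $(0,1)$ satisfies the identity $$(-\Delta)^s_\omega(p_n)=\frac{\Gamma(2s+n+1)}{n!}\,p_n .$$
   Context: Weighted operator: for $s\in(0,1)$ and a bounded interval $(a,b)$, let $\omega^s(y)=(y-a)^s(b-y)^s$. For $\phi\in C^2(a,b)\cap C^1[a,b]$ (not necessarily vanishing at $a,b$) and $x\in(a,b)$ define $$(-\Delta)^s_\omega[\phi](x)=C_s\frac{d}{dx}\int_a^b|x-y|^{1-2s}\frac{d}{dy}\big(\omega^s(y)\phi(y)\big)\,dy\quad (s\neq 1/2),$$ $$(-\Delta)^{1/2}_\omega[\phi](x)=\frac1\pi\frac{d}{dx}\int_a^b\ln|x-y|\,\frac{d}{dy}\big(\omega^{1/2}(y)\phi(y)\big)\,dy\quad (s=1/2),$$ where $C_s=-\Gamma(2s-1)\sin(\pi s)/\pi$ for $s\neq 1/2$. In the claim, $(a,b)=(0,1)$. Gegenbauer polynomials: $C_0^{(\alpha)}(x)=1$, $C_1^{(\alpha)}(x)=2\alpha x$, and $C_n^{(\alpha)}(x)=\frac1n\left[2x(n+\alpha-1)C_{n-1}^{(\alpha)}(x)-(n+2\alpha-2)C_{n-2}^{(\alpha)}(x)\right]$ for $n\ge2$. *)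

theory Defs
  imports "HOL-Analysis.Analysis"
begin

fun gegenbauer :: "real \<Rightarrow> nat \<Rightarrow> real \<Rightarrow> real" where
  "gegenbauer \<alpha> 0 x = 1"
| "gegenbauer \<alpha> (Suc 0) x = 2 * \<alpha> * x"
| "gegenbauer \<alpha> (Suc (Suc k)) x =
     1 / real (k + 2) *
       (2 * x * (real (k + 2) + \<alpha> - 1) * gegenbauer \<alpha> (Suc k) x
        - (real (k + 2) + 2 * \<alpha> - 2) * gegenbauer \<alpha> k x)"

definition weight :: "real \<Rightarrow> real \<Rightarrow> real \<Rightarrow> real \<Rightarrow> real" where
  "weight s a b y = (y - a) powr s * (b - y) powr s"

definition frac_const :: "real \<Rightarrow> real" where
  "frac_const s = (if s = 1/2 then 1 / pi else - Gamma (2 * s - 1) * sin (pi * s) / pi)"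

definition frac_kernel :: "real \<Rightarrow> real \<Rightarrow> real" where
  "frac_kernel s z = (if s = 1/2 then ln \<bar>z\<bar> else \<bar>z\<bar> powr (1 - 2 * s))"

definition weighted_integrand ::
    "real \<Rightarrow> real \<Rightarrow> real \<Rightarrow> (real \<Rightarrow> real) \<Rightarrow> real \<Rightarrow> real \<Rightarrow> real" where
  "weighted_integrand s a b \<phi> x y =
     frac_kernel s (x - y) * deriv (\<lambda>t. weight s a b t * \<phi> t) y"

definition weighted_potential ::
    "real \<Rightarrow> real \<Rightarrow> real \<Rightarrow> (real \<Rightarrow> real) \<Rightarrow> real \<Rightarrow> real" where
  "weighted_potential s a b \<phi> x = (LBINT y:{a<..<b}. weighted_integrand s a b \<phi> x y)"

definition weighted_frac_laplacian ::
    "real \<Rightarrow> real \<Rightarrow> real \<Rightarrow> (real \<Rightarrow> real) \<Rightarrow> real \<Rightarrow> real" where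
  "weighted_frac_laplacian s a b \<phi> x = frac_const s * deriv (weighted_potential s a b \<phi>) x"

text \<open>
  Derivatives and integrals are total functions here. The following predicate says that those
  occurring in \<^const>\<open>weighted_frac_laplacian\<close> at a point \<^term>\<open>x\<close> of the interval really exist.
\<close>

definition weighted_frac_laplacian_exists ::
    "real \<Rightarrow> real \<Rightarrow> real \<Rightarrow> (real \<Rightarrow> real) \<Rightarrow> real \<Rightarrow> bool" where
  "weighted_frac_laplacian_exists s a b \<phi> x \<longleftrightarrow>
     (\<forall>y\<in>{a<..<b}. (\<lambda>t. weight s a b t * \<phi> t) field_differentiable at y) \<and>
     (\<forall>z\<in>{a<..<b}. set_integrable lborel {a<..<b} (weighted_integrand s a b \<phi> z)) \<and>
     weighted_potential s a b \<phi> field_differentiable at x"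

end

theory Submission
  imports Defs "HOL-Computational_Algebra.Polynomial" "HOL-Real_Asymp.Real_Asymp"
begin

text \<open>
  Let \<open>W = x (1 - x)\<close>. Since \<open>(W\<^sup>s f)' = W\<^sup>s\<^sup>-\<^sup>1 B f\<close> with \<open>B f = W f' + s W' f\<close>, the weighted operator is a constant
  times \<open>f \<mapsto> A (B f)\<close>, where \<open>A f = (T f)'\<close> and \<open>T f (x) = \<integral> K (x - y) W (y)\<^sup>s\<^sup>-\<^sup>1 f (y) dy\<close> with the power or logarithmic
  kernel \<open>K\<close>. The kernel is even, integrable near \<open>0\<close>, and satisfies \<open>(z K (z))' = (2 - 2 s) K (z) + \<gamma>\<close>, where
  \<open>\<gamma> = 1\<close> if \<open>s = 1/2\<close> and \<open>\<gamma> = 0\<close> otherwise.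

  Let \<open>G f\<close> be the analogue of \<open>T f\<close> for the continuous kernel \<open>z K (z)\<close>. Then \<open>G f = x T f - T (x f)\<close>, the
  derivative of \<open>G f\<close> is \<open>(2 - 2 s) T f + const\<close> (\<open>G_has_derivative\<close>), and integration by parts gives
  \<open>G (B f) = (2 - 2 s) T (W f) + const\<close> (\<open>G_B\<close>). For \<open>f = 1\<close> these relations imply that \<open>T 1\<close> is
  differentiable and that \<open>a = (T 1)'\<close> satisfies \<open>W a' + s W' a = 0\<close>; as \<open>a\<close> is odd about \<open>1/2\<close>, it is zero
  (\<open>T_1_const\<close>). From the constant \<open>T 1\<close> it follows by induction that \<open>T\<close> maps polynomials to polynomials.

  On polynomials, with \<open>D\<close> for the derivative and \<open>x\<close>, \<open>W\<close> for the multiplications, the same relations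
  become \<open>D A x = (x D + 2 s) A\<close> and \<open>D A W = A B\<close>. Together they yield \<open>A W D = B A\<close> (\<open>A_W_pderiv\<close>), so
  that \<open>D B A B = D A W D B = A B D B\<close>: the operator \<open>A B\<close> commutes with \<open>D B\<close> (\<open>AB_commutes\<close>). The
  Gegenbauer differential equation says that \<open>p\<^sub>n\<close>, the polynomial of the theorem, is an eigenfunction
  of \<open>D B\<close> (\<open>gegenbauer_poly_eigen\<close>). The eigenvalues \<open>- (n + 1) (n + 2 s)\<close> are distinct and \<open>A B\<close> does
  not raise degrees, hence \<open>p\<^sub>n\<close> is an eigenfunction of \<open>A B\<close> too. Its eigenvalue is read off the leading
  coefficients, up to the factor \<open>A x\<close>, a constant that a Beta integral and the reflection formula
  for \<open>\<Gamma>\<close> determine (\<open>frac_const_times\<close>).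
\<close>

section \<open>Convolution with weakly singular kernels\<close>

text \<open>
  The kernel is singular at \<open>0\<close> only and the density at the endpoints \<open>0\<close> and \<open>1\<close> only. Near an interior
  point \<open>x0\<close> the density splits into a bounded part on a neighbourhood \<open>N\<close> of \<open>x0\<close> and a part supported
  off \<open>N\<close>, against which the kernel is bounded. Both parts pass to the limit by dominated convergence,
  the first one after the substitution \<open>z = x - y\<close>, which moves the singularity to a fixed place.
\<close>
lemma weakly_singular_convolution:
  fixes \<kappa> \<phi> :: "real \<Rightarrow> real"
  assumes cont_\<kappa>: "continuous_on (- {0}) \<kappa>"
    and int_\<kappa>: "set_integrable lborel {-1..1} \<kappa>"
    and int_\<phi>: "set_integrable lborel {0<..<1} \<phi>"
    and cont_\<phi>: "continuous_on {0<..<1} \<phi>"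
    and x0: "x0 \<in> {0<..<1}"
  shows "set_integrable lborel {0<..<1} (\<lambda>y. \<kappa> (x0 - y) * \<phi> y)"
    and "isCont (\<lambda>x. LBINT y:{0<..<1}. \<kappa> (x - y) * \<phi> y) x0"
proof -
  define r where "r = min x0 (1 - x0) / 3"
  have r: "r > 0" "3 * r \<le> x0" "3 * r \<le> 1 - x0" using x0 by (auto simp: r_def)
  define N where "N = {x0 - 2*r .. x0 + 2*r}"
  have N: "N \<subseteq> {0<..<1}" using r by (auto simp: N_def)
  define \<phi>1 where "\<phi>1 y = indicator N y * \<phi> y" for y
  define \<phi>2 where "\<phi>2 y = indicator ({0<..<1} - N) y * \<phi> y" for y
  define I where "I = {x0 - r .. x0 + r}"
  obtain M where M: "\<And>y. y \<in> N \<Longrightarrow> \<bar>\<phi> y\<bar> \<le> M" and M0: "M \<ge> 0"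
  proof -
    have "compact (\<phi> ` N)"
      by (rule compact_continuous_image[OF continuous_on_subset[OF cont_\<phi> N]]) (simp add: N_def)
    then obtain M where M: "\<forall>y\<in>N. norm (\<phi> y) \<le> M"
      using compact_imp_bounded bounded_iff by (metis image_eqI)
    have "x0 \<in> N" using r by (simp add: N_def)
    then have "M \<ge> 0" using M norm_ge_zero order_trans by blast
    then show ?thesis using that M by auto
  qed
  obtain M' where M': "\<And>z. r \<le> \<bar>z\<bar> \<Longrightarrow> \<bar>z\<bar> \<le> 1 \<Longrightarrow> \<bar>\<kappa> z\<bar> \<le> M'" and M'0: "M' \<ge> 0"
  proof -
    have eq: "{z::real. r \<le> \<bar>z\<bar> \<and> \<bar>z\<bar> \<le> 1} = {-1..-r} \<union> {r..1}" using r by auto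
    have "compact (\<kappa> ` {z. r \<le> \<bar>z\<bar> \<and> \<bar>z\<bar> \<le> 1})"
      unfolding eq by (rule compact_continuous_image[OF continuous_on_subset[OF cont_\<kappa>]]) (use r in auto)
    then obtain M where M: "\<forall>z\<in>{z. r \<le> \<bar>z\<bar> \<and> \<bar>z\<bar> \<le> 1}. norm (\<kappa> z) \<le> M"
      using compact_imp_bounded bounded_iff by (metis image_eqI)
    have "r \<in> {z. r \<le> \<bar>z\<bar> \<and> \<bar>z\<bar> \<le> 1}" using r x0 by auto
    then have "M \<ge> 0" using M norm_ge_zero order_trans by blast
    then show ?thesis using that M by auto
  qed
  have meas_\<kappa>[measurable]: "\<kappa> \<in> borel_measurable borel"
    by (rule borel_measurable_continuous_countable_exceptions[where X="{0}"])
       (use cont_\<kappa> in auto)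
  have int_\<phi>': "integrable lborel (\<lambda>y. indicator {0<..<1} y * \<phi> y)"
    using int_\<phi> by (simp add: set_integrable_def)
  have int_\<kappa>': "integrable lborel (\<lambda>y. indicator {-1..1} y * \<kappa> y)"
    using int_\<kappa> by (simp add: set_integrable_def)
  have [measurable]: "(\<lambda>y. indicator {0<..<1} y * \<phi> y) \<in> borel_measurable borel"
    using int_\<phi>' by auto
  have \<phi>1_alt: "\<phi>1 = (\<lambda>y. indicator N y * (indicator {0<..<1} y * \<phi> y))"
    using N by (auto simp: \<phi>1_def fun_eq_iff indicator_def)
  have \<phi>2_alt: "\<phi>2 = (\<lambda>y. indicator (-N) y * (indicator {0<..<1} y * \<phi> y))"
    by (auto simp: \<phi>2_def fun_eq_iff indicator_def)
  have [measurable]: "N \<in> sets borel" by (simp add: N_def)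
  have [measurable]: "\<phi>1 \<in> borel_measurable borel" unfolding \<phi>1_alt by measurable
  have [measurable]: "\<phi>2 \<in> borel_measurable borel" unfolding \<phi>2_alt by measurable
  \<comment> \<open>The near part is written in the variable \<open>z = x - y\<close>, the far part in \<open>y\<close>.\<close>
  define h1 where "h1 x z = \<kappa> z * \<phi>1 (x - z)" for x z
  define h2 where "h2 x y = \<kappa> (x - y) * \<phi>2 y" for x y
  have b1: "norm (h1 x z) \<le> M * \<bar>indicator {-1..1} z * \<kappa> z\<bar>" if "x \<in> I" for x z
  proof (cases "x - z \<in> N")
    case True
    then have "z \<in> {-1..1}" using that r x0 by (auto simp: I_def N_def)
    moreover have "\<bar>\<kappa> z * \<phi> (x - z)\<bar> \<le> M * \<bar>\<kappa> z\<bar>"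
      using mult_left_mono[OF M[OF True], of "\<bar>\<kappa> z\<bar>"] by (simp add: abs_mult mult.commute)
    ultimately show ?thesis using True by (auto simp: h1_def \<phi>1_def)
  qed (use M0 in \<open>auto simp: h1_def \<phi>1_def\<close>)
  have b2: "norm (h2 x y) \<le> M' * \<bar>indicator {0<..<1} y * \<phi> y\<bar>" if "x \<in> I" for x y
  proof (cases "y \<in> {0<..<1} - N")
    case True
    then have "r \<le> \<bar>x - y\<bar>" "\<bar>x - y\<bar> \<le> 1" using that r x0 by (auto simp: I_def N_def)
    from mult_right_mono[OF M'[OF this], of "\<bar>\<phi> y\<bar>"] True show ?thesis 
      by (auto simp: h2_def \<phi>2_def abs_mult)
  qed (use M'0 in \<open>auto simp: h2_def \<phi>2_def\<close>)
  have int1: "integrable lborel (h1 x)" if "x \<in> I" for x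
  proof (rule Bochner_Integration.integrable_bound)
    show "integrable lborel (\<lambda>z. M * \<bar>indicator {-1..1} z * \<kappa> z\<bar>)"
      using int_\<kappa>' by (intro integrable_mult_right integrable_abs)
    show "AE z in lborel. norm (h1 x z) \<le> norm (M * \<bar>indicator {-1..1} z * \<kappa> z\<bar>)"
      using b1[OF that] M0 by simp
  qed (simp add: h1_def[abs_def])
  have int2: "integrable lborel (h2 x)" if "x \<in> I" for x
  proof (rule Bochner_Integration.integrable_bound)
    show "integrable lborel (\<lambda>y. M' * \<bar>indicator {0<..<1} y * \<phi> y\<bar>)"
      using int_\<phi>' by (intro integrable_mult_right integrable_abs)
    show "AE y in lborel. norm (h2 x y) \<le> norm (M' * \<bar>indicator {0<..<1} y * \<phi> y\<bar>)"
      using b2[OF that] M'0 by simp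
  qed (simp add: h2_def[abs_def])
  have split: "indicator {0<..<1} y * (\<kappa> (x - y) * \<phi> y) = h1 x (x - y) + h2 x y" for x y
    using N by (auto simp: h1_def h2_def \<phi>1_def \<phi>2_def indicator_def)
  have int1': "integrable lborel (\<lambda>y. h1 x (x - y))" if "x \<in> I" for x
    using lborel_integrable_real_affine[OF int1[OF that], of "-1" x] by simp
  have int: "set_integrable lborel {0<..<1} (\<lambda>y. \<kappa> (x - y) * \<phi> y)" if "x \<in> I" for x
    using int1'[OF that] int2[OF that] unfolding set_integrable_def real_scaleR_def split by simp
  have val: "(LBINT y:{0<..<1}. \<kappa> (x - y) * \<phi> y) = integral\<^sup>L lborel (h1 x) + integral\<^sup>L lborel (h2 x)"
    if "x \<in> I" for x
  proof -
    have "(LBINT y:{0<..<1}. \<kappa> (x - y) * \<phi> y) = (\<integral>y. h1 x (x - y) + h2 x y \<partial>lborel)"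
      unfolding set_lebesgue_integral_def real_scaleR_def split ..
    also have "\<dots> = (\<integral>y. h1 x (x - y) \<partial>lborel) + integral\<^sup>L lborel (h2 x)"
      using int1'[OF that] int2[OF that] by simp
    also have "(\<integral>y. h1 x (x - y) \<partial>lborel) = integral\<^sup>L lborel (h1 x)"
      using lborel_integral_real_affine[of "-1" "h1 x" x] by simp
    finally show ?thesis .
  qed
  have x0I: "x0 \<in> I" using r by (simp add: I_def)
  then show "set_integrable lborel {0<..<1} (\<lambda>y. \<kappa> (x0 - y) * \<phi> y)" by (rule int)
  have "continuous_on I (\<lambda>x. LBINT y:{0<..<1}. \<kappa> (x - y) * \<phi> y)"
    unfolding continuous_on_sequentially comp_def
  proof safe
    fix X a assume a: "a \<in> I" and X: "\<forall>n. X n \<in> I" and lim: "X \<longlonglongrightarrow> a"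
    have l1: "(\<lambda>n. integral\<^sup>L lborel (h1 (X n))) \<longlonglongrightarrow> integral\<^sup>L lborel (h1 a)"
    proof (rule integral_dominated_convergence[where w="\<lambda>z. M * \<bar>indicator {-1..1} z * \<kappa> z\<bar>"])
      \<comment> \<open>The truncated density \<open>\<phi>1\<close> jumps at the two endpoints of \<open>N\<close>.\<close>
      have ae: "AE z in lborel. z \<noteq> a - (x0 - 2*r) \<and> z \<noteq> a - (x0 + 2*r)"
        using AE_lborel_singleton[of "a - (x0 - 2*r)"] AE_lborel_singleton[of "a - (x0 + 2*r)"] 
        by eventually_elim auto
      show "AE z in lborel. (\<lambda>n. h1 (X n) z) \<longlonglongrightarrow> h1 a z"
        using ae
      proof eventually_elim
        case (elim z)
        have lz: "(\<lambda>n. X n - z) \<longlonglongrightarrow> a - z" by (intro tendsto_intros lim)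
        have "isCont \<phi>1 (a - z)"
        proof (cases "a - z \<in> {x0 - 2*r<..<x0 + 2*r}")
          case True
          then have "a - z \<in> N" by (auto simp: N_def)
          then have "isCont \<phi> (a - z)" using cont_\<phi> N
            by (auto simp: continuous_on_eq_continuous_at)
          moreover have "\<forall>\<^sub>F y in nhds (a - z). y \<in> {x0 - 2*r<..<x0 + 2*r}"
            by (rule eventually_nhds_in_open) (use True in auto)
          then have "\<forall>\<^sub>F y in nhds (a - z). \<phi>1 y = \<phi> y"
            by eventually_elim (auto simp: \<phi>1_def N_def)
          ultimately show ?thesis by (subst isCont_cong) 
        next
          case False
          have "\<forall>\<^sub>F y in nhds (a - z). y \<in> - N"
            by (rule eventually_nhds_in_open) (use False elim in \<open>auto simp: N_def\<close>)
          then have "\<forall>\<^sub>F y in nhds (a - z). \<phi>1 y = 0"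
            by eventually_elim (auto simp: \<phi>1_def)
          then show ?thesis by (subst isCont_cong) auto
        qed
        from isCont_tendsto_compose[OF this lz] show ?case 
          unfolding h1_def by (intro tendsto_intros)
      qed
      show "AE z in lborel. norm (h1 (X n) z) \<le> M * \<bar>indicator {-1..1} z * \<kappa> z\<bar>" for n
        using b1 X by auto
    qed (use int_\<kappa>' in \<open>auto simp: h1_def[abs_def] intro!: integrable_mult_right integrable_abs\<close>)
    have l2: "(\<lambda>n. integral\<^sup>L lborel (h2 (X n))) \<longlonglongrightarrow> integral\<^sup>L lborel (h2 a)"
    proof (rule integral_dominated_convergence[where w="\<lambda>y. M' * \<bar>indicator {0<..<1} y * \<phi> y\<bar>"])
      have "(\<lambda>n. h2 (X n) y) \<longlonglongrightarrow> h2 a y" for y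
      proof (cases "y \<in> {0<..<1} - N")
        case True
        then have "a - y \<noteq> 0" using a r by (auto simp: I_def N_def)
        then have "isCont \<kappa> (a - y)" using cont_\<kappa> by (simp add: continuous_on_eq_continuous_at open_Compl)
        moreover have "(\<lambda>n. X n - y) \<longlonglongrightarrow> a - y" by (intro tendsto_intros lim)
        ultimately have "(\<lambda>n. \<kappa> (X n - y)) \<longlonglongrightarrow> \<kappa> (a - y)" by (rule isCont_tendsto_compose)
        then show ?thesis unfolding h2_def by (intro tendsto_intros)
      qed (auto simp: h2_def \<phi>2_def)
      then show "AE y in lborel. (\<lambda>n. h2 (X n) y) \<longlonglongrightarrow> h2 a y" by simp
      show "AE z in lborel. norm (h2 (X n) z) \<le> M' * \<bar>indicator {0<..<1} z * \<phi> z\<bar>" for n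
        using b2 X by auto
    qed (use int_\<phi>' in \<open>auto simp: h2_def[abs_def] intro!: integrable_mult_right integrable_abs\<close>)
    show "(\<lambda>n. LBINT y:{0<..<1}. \<kappa> (X n - y) * \<phi> y) \<longlonglongrightarrow> (LBINT y:{0<..<1}. \<kappa> (a - y) * \<phi> y)"
      using tendsto_add[OF l1 l2] val X a by simp
  qed
  then show "isCont (\<lambda>x. LBINT y:{0<..<1}. \<kappa> (x - y) * \<phi> y) x0"
    by (rule continuous_on_interior) (use r in \<open>auto simp: I_def interior_atLeastAtMost_real\<close>)
qed

text \<open>
  Differentiation under the integral, although the difference quotients of \<open>g\<close> have no integrable
  majorant: by Fubini, the convolution with \<open>g\<close> is a primitive of the convolution with \<open>\<kappa>\<close>, and the
  latter is continuous.
\<close>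
lemma weakly_singular_convolution_deriv:
  fixes \<kappa> \<phi> g :: "real \<Rightarrow> real"
  assumes cont_\<kappa>: "continuous_on (- {0}) \<kappa>"
    and int_\<kappa>: "set_integrable lborel {-1..1} \<kappa>"
    and cont_g: "continuous_on UNIV g"
    and deriv_g: "\<And>z. z \<noteq> 0 \<Longrightarrow> (g has_real_derivative \<kappa> z) (at z)"
    and int_\<phi>: "set_integrable lborel {0<..<1} \<phi>"
    and cont_\<phi>: "continuous_on {0<..<1} \<phi>"
    and x0: "x0 \<in> {0<..<1}"
  shows "((\<lambda>x. LBINT y:{0<..<1}. g (x - y) * \<phi> y) has_real_derivative
           (LBINT y:{0<..<1}. \<kappa> (x0 - y) * \<phi> y)) (at x0)"
proof -
  define a b where "a = x0 / 2" and "b = (1 + x0) / 2"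
  have ab: "0 < a" "a < x0" "x0 < b" "b < 1" using x0 by (auto simp: a_def b_def)
  define H where "H x = (LBINT y:{0<..<1}. g (x - y) * \<phi> y)" for x
  define S where "S x = (LBINT y:{0<..<1}. \<kappa> (x - y) * \<phi> y)" for x
  define \<psi> where "\<psi> y = indicator {0<..<1} y * \<phi> y" for y
  have int_\<psi>: "integrable lborel \<psi>" using int_\<phi> by (simp add: set_integrable_def \<psi>_def[abs_def])
  have [measurable]: "\<psi> \<in> borel_measurable borel" using int_\<psi> by auto
  have [measurable]: "\<kappa> \<in> borel_measurable borel"
    by (rule borel_measurable_continuous_countable_exceptions[where X="{0}"])
       (use cont_\<kappa> in auto)
  have int_\<kappa>': "integrable lborel (\<lambda>y. indicator {-1..1} y * \<kappa> y)"
    using int_\<kappa> by (simp add: set_integrable_def)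
  define C where "C = (\<integral>z. \<bar>indicator {-1..1} z * \<kappa> z\<bar> \<partial>lborel)"
  have contS: "continuous_on {a..b} S"
    using weakly_singular_convolution(2)[OF cont_\<kappa> int_\<kappa> int_\<phi> cont_\<phi>] ab
    unfolding S_def[abs_def] by (intro continuous_at_imp_continuous_on) auto
  have int_g: "integrable lborel (\<lambda>y. g (x - y) * \<psi> y)" if "x \<in> {a..b}" for x
  proof -
    have "set_integrable lborel {0<..<1} (\<lambda>y. g (x - y) * \<phi> y)"
      by (rule weakly_singular_convolution(1)[OF _ _ int_\<phi> cont_\<phi>])
         (use that ab cont_g in \<open>auto intro: continuous_on_subset borel_integrable_atLeastAtMost'\<close>)
    then show ?thesis by (simp add: set_integrable_def \<psi>_def mult_ac)
  qed
  have Hdiff: "H x = H a + integral {a..x} S" if x: "x \<in> {a..b}" for x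
  proof -
    define f where "f y t = indicator {a..x} t * \<kappa> (t - y) * \<psi> y" for y t
    have shift: "integrable lborel (\<lambda>t. indicator {-1..1} (t - y) * \<kappa> (t - y))"
      "(\<integral>t. \<bar>indicator {-1..1} (t - y) * \<kappa> (t - y)\<bar> \<partial>lborel) = C" for y
      using lborel_integrable_real_affine[OF int_\<kappa>', of 1 "-y"]
        lborel_integral_real_affine[of 1 "\<lambda>z. \<bar>indicator {-1..1} z * \<kappa> z\<bar>" "-y"]
      by (simp_all add: C_def)
    have le: "\<bar>indicator {a..x} t * \<kappa> (t - y)\<bar> \<le> \<bar>indicator {-1..1} (t - y) * \<kappa> (t - y)\<bar>"
      if "y \<in> {0<..<1}" for t y
      using that ab x by (auto simp: indicator_def)
    have int_t: "integrable lborel (\<lambda>t. indicator {a..x} t * \<kappa> (t - y))" if "y \<in> {0<..<1}" for y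
      by (rule Bochner_Integration.integrable_bound[OF shift(1)[of y]]) (use le[OF that] in auto)
    have int_ty: "integrable lborel (\<lambda>t. f y t)" for y
    proof (cases "y \<in> {0<..<1}")
      case True
      then show ?thesis unfolding f_def by (intro integrable_mult_left int_t)
    qed (simp add: f_def \<psi>_def)
    have bound: "\<bar>\<integral>t. \<bar>f y t\<bar> \<partial>lborel\<bar> \<le> C * \<bar>\<psi> y\<bar>" for y
    proof (cases "y \<in> {0<..<1}")
      case True
      have "(\<integral>t. \<bar>indicator {a..x} t * \<kappa> (t - y)\<bar> \<partial>lborel) \<le> C"
        unfolding shift(2)[of y, symmetric]
        by (intro integral_mono integrable_abs int_t shift True le)
      from mult_right_mono[OF this, of "\<bar>\<psi> y\<bar>"] show ?thesis
        by (simp add: f_def abs_mult)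
    qed (simp add: f_def \<psi>_def)
    have int2: "integrable (lborel \<Otimes>\<^sub>M lborel) (case_prod f)"
    proof (rule lborel_pair.Fubini_integrable)
      show "case_prod f \<in> borel_measurable (lborel \<Otimes>\<^sub>M lborel)"
        unfolding f_def by measurable
      show "integrable lborel (\<lambda>y. \<integral>t. norm (case (y, t) of (y, t) \<Rightarrow> f y t) \<partial>lborel)"
      proof (rule Bochner_Integration.integrable_bound[where f="\<lambda>y. C * \<bar>\<psi> y\<bar>"])
        show "(\<lambda>y. \<integral>t. norm (case (y, t) of (y, t) \<Rightarrow> f y t) \<partial>lborel) \<in> borel_measurable lborel"
          unfolding f_def by measurable
        have "C \<ge> 0" by (simp add: C_def)
        then show "AE y in lborel. norm (\<integral>t. norm (case (y, t) of (y, t) \<Rightarrow> f y t) \<partial>lborel) \<le> norm (C * \<bar>\<psi> y\<bar>)"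
          using bound by (simp add: abs_mult)
      qed (use int_\<psi> in auto)
      show "AE y in lborel. integrable lborel (\<lambda>t. case (y, t) of (y, t) \<Rightarrow> f y t)"
        using int_ty by simp
    qed
    have inner: "(\<integral>t. f y t \<partial>lborel) = g (x - y) * \<psi> y - g (a - y) * \<psi> y" for y
    proof (cases "y \<in> {0<..<1}")
      case True
      have "((\<lambda>t. \<kappa> (t - y)) has_integral (g (x - y) - g (a - y))) {a..x}"
      proof (rule fundamental_theorem_of_calculus_interior_strong[of "{y}"])
        show "continuous_on {a..x} (\<lambda>t. g (t - y))"
          by (intro continuous_on_compose2[OF cont_g] continuous_intros) auto
        fix t assume "t \<in> {a<..<x} - {y}"
        then have "((\<lambda>t. g (t - y)) has_real_derivative \<kappa> (t - y)) (at t)"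
          using DERIV_shift[of g "\<kappa> (t - y)" t "-y"] deriv_g[of "t - y"] by simp
        then show "((\<lambda>t. g (t - y)) has_vector_derivative \<kappa> (t - y)) (at t)"
          by (simp add: has_real_derivative_iff_has_vector_derivative)
      qed (use x in auto)
      moreover have "set_integrable lborel {a..x} (\<lambda>t. \<kappa> (t - y))"
        using int_t[OF True] by (simp add: set_integrable_def)
      ultimately have "(\<integral>t. indicator {a..x} t * \<kappa> (t - y) \<partial>lborel) = g (x - y) - g (a - y)"
        using set_borel_integral_eq_integral(2)[of "{a..x}" "\<lambda>t. \<kappa> (t - y)"]
        by (simp add: integral_unique set_lebesgue_integral_def)
      moreover have "(\<integral>t. f y t \<partial>lborel) = (\<integral>t. indicator {a..x} t * \<kappa> (t - y) \<partial>lborel) * \<psi> y"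
        by (simp add: f_def)
      ultimately show ?thesis by (simp add: left_diff_distrib)
    qed (simp add: f_def \<psi>_def)
    have "integral {a..x} S = (LBINT t:{a..x}. S t)"
      by (rule set_borel_integral_eq_integral(2)[symmetric], rule borel_integrable_atLeastAtMost')
         (use contS x in \<open>auto intro: continuous_on_subset\<close>)
    also have "\<dots> = (\<integral>t. (\<integral>y. f y t \<partial>lborel) \<partial>lborel)"
    proof (unfold set_lebesgue_integral_def, rule Bochner_Integration.integral_cong)
      fix t
      have "(\<integral>y. f y t \<partial>lborel) = (\<integral>y. indicator {a..x} t * (indicator {0<..<1} y * (\<kappa> (t - y) * \<phi> y)) \<partial>lborel)"
        by (simp add: f_def \<psi>_def mult_ac)
      also have "\<dots> = indicator {a..x} t * S t"
        by (simp add: S_def set_lebesgue_integral_def)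
      finally show "indicator {a..x} t *\<^sub>R S t = (\<integral>y. f y t \<partial>lborel)" by simp
    qed simp
    also have "\<dots> = (\<integral>y. (\<integral>t. f y t \<partial>lborel) \<partial>lborel)"
      by (rule lborel_pair.Fubini_integral[OF int2])
    also have "\<dots> = (\<integral>y. g (x - y) * \<psi> y - g (a - y) * \<psi> y \<partial>lborel)"
      unfolding inner ..
    also have "\<dots> = (\<integral>y. g (x - y) * \<psi> y \<partial>lborel) - (\<integral>y. g (a - y) * \<psi> y \<partial>lborel)"
      using int_g x ab by simp
    also have "\<dots> = H x - H a" by (simp add: H_def set_lebesgue_integral_def \<psi>_def mult_ac)
    finally show ?thesis by simp
  qed
  have "((\<lambda>x. H a + integral {a..x} S) has_real_derivative 0 + S x0) (at x0 within {a..b})"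
    by (intro DERIV_add DERIV_const integral_has_real_derivative contS) (use ab in auto)
  then have "((\<lambda>x. H a + integral {a..x} S) has_real_derivative S x0) (at x0)"
    using ab by (simp add: at_within_Icc_at)
  then have "(H has_real_derivative S x0) (at x0)"
  proof (rule has_field_derivative_transform_within_open[where S="{a<..<b}"])
    show "H a + integral {a..x} S = H x" if "x \<in> {a<..<b}" for x
      by (rule Hdiff[symmetric]) (use that in auto)
  qed (use ab in auto)
  then show ?thesis by (simp add: H_def[abs_def] S_def)
qed

section \<open>Polynomial identities on an interval and the reflection formula\<close>

lemma poly_eqI_Ioo:
  fixes p q :: "real poly"
  assumes "\<And>x. x \<in> {0<..<1} \<Longrightarrow> poly p x = poly q x"
  shows "p = q"
proof (rule ccontr)
  assume "p \<noteq> q"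
  then have "finite {x. poly (p - q) x = 0}" by (intro poly_roots_finite) simp
  then have "finite {0<..<1::real}" by (rule finite_subset[rotated]) (use assms in auto)
  then show False by (simp add: infinite_Ioo)
qed

lemma poly_antideriv_exists:
  fixes p :: "real poly"
  shows "\<exists>r. pderiv r = p"
proof -
  have pderiv_sum: "pderiv (\<Sum>i\<in>I. f i) = (\<Sum>i\<in>I. pderiv (f i))" for f :: "nat \<Rightarrow> real poly" and I
    by (induction I rule: infinite_finite_induct) (simp_all add: pderiv_add)
  have "pderiv (\<Sum>i\<le>degree p. monom (coeff p i / real (Suc i)) (Suc i)) = (\<Sum>i\<le>degree p. monom (coeff p i) i)"
    by (simp add: pderiv_sum pderiv_monom del: of_nat_Suc)
  then show ?thesis by (auto simp: poly_as_sum_of_monoms)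
qed

lemma Gamma_reflection_real: "Gamma x * Gamma (1 - x) = pi / sin (pi * x)" for x :: real
proof -
  have "complex_of_real (Gamma x * Gamma (1 - x)) = complex_of_real (pi / sin (pi * x))"
    using Gamma_reflection_complex[of "complex_of_real x"]
    by (simp flip: Gamma_complex_of_real sin_of_real)
  then show ?thesis by (simp only: of_real_eq_iff)
qed

section \<open>The fractional kernel\<close>

lemma set_integrable_lborel_nonneg:
  fixes f :: "real \<Rightarrow> real"
  assumes "f integrable_on A" "\<And>x. x \<in> A \<Longrightarrow> 0 \<le> f x" "set_borel_measurable lborel A f"
  shows "set_integrable lborel A f"
proof -
  have "f absolutely_integrable_on A"
    by (rule nonnegative_absolutely_integrable_1) (use assms in auto)
  then show ?thesis
    using assms(3) unfolding set_integrable_def set_borel_measurable_def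
    by (simp add: integrable_completion)
qed

lemma frac_kernel_minus [simp]: "frac_kernel s (- z) = frac_kernel s z"
  by (simp add: frac_kernel_def)

lemma continuous_on_frac_kernel: "continuous_on (- {0}) (frac_kernel s)"
  by (cases "s = 1/2") (auto simp: frac_kernel_def[abs_def] intro!: continuous_intros)

lemma continuous_on_times_frac_kernel:
  assumes "s < 1"
  shows "continuous_on UNIV (\<lambda>z. z * frac_kernel s z)"
proof -
  have "isCont (\<lambda>z. z * frac_kernel s z) z" for z
  proof (cases "z = 0")
    case False
    then have "isCont (frac_kernel s) z"
      using continuous_on_frac_kernel[of s] by (simp add: continuous_on_eq_continuous_at open_Compl)
    then show ?thesis by (intro continuous_intros)
  next
    case True
    have pos: "2 - 2 * s > 0" using assms by simp
    have "((\<lambda>z. z * frac_kernel s z) \<longlongrightarrow> 0) (at_right 0)"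
    proof (cases "s = 1/2")
      case True
      have "((\<lambda>z::real. z * ln \<bar>z\<bar>) \<longlongrightarrow> 0) (at_right 0)" by real_asymp
      then show ?thesis using True by (simp add: frac_kernel_def)
    next
      case False
      have "((\<lambda>z::real. z powr (2 - 2 * s)) \<longlongrightarrow> 0) (at_right 0)" using pos by real_asymp
      moreover have "\<forall>\<^sub>F z in at_right 0. z powr (2 - 2 * s) = z * frac_kernel s z"
        using eventually_at_right_less[of "0::real"]
      proof eventually_elim
        case (elim z)
        have "z powr (2 - 2 * s) = z powr (1 + (1 - 2 * s))" by simp
        also have "\<dots> = z * z powr (1 - 2 * s)" using elim by (subst powr_add) simp
        finally show ?case using elim False by (simp add: frac_kernel_def)
      qed
      ultimately show ?thesis by (rule Lim_transform_eventually)
    qed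
    moreover from tendsto_minus[OF this]
    have "((\<lambda>z. z * frac_kernel s z) \<longlongrightarrow> 0) (at_left 0)"
      by (simp add: filterlim_at_left_to_right)
    ultimately have "((\<lambda>z. z * frac_kernel s z) \<longlongrightarrow> 0) (at 0)" by (rule filterlim_split_at_real[rotated])
    then show ?thesis using True by (simp add: isCont_def)
  qed
  then show ?thesis by (simp add: continuous_on_eq_continuous_at)
qed

text \<open>
  The derivative of \<open>z * frac_kernel s z\<close> is \<open>(2 - 2 * s) * frac_kernel s z\<close> plus a constant that appears
  for the logarithmic kernel only. With this constant the cases \<open>s = 1/2\<close> and \<open>s \<noteq> 1/2\<close> run in parallel.
\<close>
definition log_term :: "real \<Rightarrow> real" where
  "log_term s = (if s = 1/2 then 1 else 0)"

lemma times_frac_kernel_deriv: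
  assumes "z \<noteq> 0"
  shows "((\<lambda>z. z * frac_kernel s z) has_real_derivative (2 - 2 * s) * frac_kernel s z + log_term s) (at z)"
proof -
  have pos: "((\<lambda>z. z * frac_kernel s z) has_real_derivative (2 - 2 * s) * frac_kernel s z + log_term s) (at z)"
    if z: "z > 0" for z
  proof (cases "s = 1/2")
    case True
    have "((\<lambda>z. z * ln z) has_real_derivative (2 - 2 * s) * frac_kernel s z + log_term s) (at z)"
      using z True by (auto intro!: derivative_eq_intros simp: frac_kernel_def log_term_def)
    then show ?thesis
      by (rule has_field_derivative_transform_within_open[where S="{0<..}"])
         (use z True in \<open>auto simp: frac_kernel_def\<close>)
  next
    case False
    have "((\<lambda>z. z * z powr (1 - 2 * s)) has_real_derivative
        1 * z powr (1 - 2 * s) + ((1 - 2 * s) * z powr (1 - 2 * s - 1)) * z) (at z)"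
      by (intro DERIV_mult DERIV_ident has_real_derivative_powr z)
    moreover have "z powr (1 - 2 * s) = z * z powr (1 - 2 * s - 1)"
      using z powr_add[of z 1 "1 - 2 * s - 1"] by simp
    ultimately have "((\<lambda>z. z * z powr (1 - 2 * s)) has_real_derivative (2 - 2 * s) * frac_kernel s z + log_term s) (at z)"
      using z False by (simp add: frac_kernel_def log_term_def algebra_simps)
    then show ?thesis
      by (rule has_field_derivative_transform_within_open[where S="{0<..}"])
         (use z False in \<open>auto simp: frac_kernel_def\<close>)
  qed
  show ?thesis
  proof (cases "z > 0")
    case False
    then have "- z > 0" using assms by simp
    from DERIV_minus[OF pos[OF this, unfolded DERIV_mirror]] show ?thesis by (simp add: add.commute)
  qed (rule pos)
qed

text \<open>
  The kernel has the primitive \<open>(z * frac_kernel s z - log_term s * z) / (2 - 2 * s)\<close>, continuous at \<open>0\<close>,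
  and constant sign on \<open>[-1, 1]\<close>.
\<close>
lemma set_integrable_frac_kernel:
  assumes "s < 1"
  shows "set_integrable lborel {-1..1} (frac_kernel s)"
proof -
  have meas: "frac_kernel s \<in> borel_measurable borel"
    by (rule borel_measurable_continuous_countable_exceptions[where X="{0}"])
       (use continuous_on_frac_kernel in auto)
  have "(frac_kernel s has_integral
      ((1 * frac_kernel s 1 - log_term s * 1) / (2 - 2 * s) - ((-1) * frac_kernel s (-1) - log_term s * (-1)) / (2 - 2 * s))) {-1..1}"
  proof (rule fundamental_theorem_of_calculus_interior_strong[of "{0}"])
    fix z :: real assume "z \<in> {-1<..<1} - {0}"
    then have "((\<lambda>z. (z * frac_kernel s z - log_term s * z) / (2 - 2 * s)) has_real_derivative
        (((2 - 2 * s) * frac_kernel s z + log_term s) - log_term s) / (2 - 2 * s)) (at z)"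
      by (intro DERIV_cdivide DERIV_diff times_frac_kernel_deriv DERIV_cmult_Id) auto
    then have "((\<lambda>z. (z * frac_kernel s z - log_term s * z) / (2 - 2 * s)) has_real_derivative frac_kernel s z) (at z)"
      using assms by simp
    then show "((\<lambda>z. (z * frac_kernel s z - log_term s * z) / (2 - 2 * s)) has_vector_derivative frac_kernel s z) (at z)"
      by (simp add: has_real_derivative_iff_has_vector_derivative)
  next
    show "continuous_on {-1..1} (\<lambda>z. (z * frac_kernel s z - log_term s * z) / (2 - 2 * s))"
      using assms by (intro continuous_intros continuous_on_subset[OF continuous_on_times_frac_kernel]) auto
  qed auto
  then have int: "frac_kernel s integrable_on {-1..1}" by blast
  show ?thesis
  proof (cases "s = 1/2")
    case False
    show ?thesis
      by (rule set_integrable_lborel_nonneg[OF int])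
         (use meas False in \<open>auto simp: frac_kernel_def set_borel_measurable_def\<close>)
  next
    case True
    have ln_nonpos: "ln \<bar>z\<bar> \<le> 0" if "- 1 \<le> z" "z \<le> 1" for z :: real
      using that by (cases "z = 0") (auto simp: ln_le_zero_iff)
    have "set_integrable lborel {-1..1} (\<lambda>z. - frac_kernel s z)"
      by (rule set_integrable_lborel_nonneg[OF integrable_neg[OF int]])
         (use meas True ln_nonpos in \<open>auto simp: frac_kernel_def set_borel_measurable_def\<close>)
    then show ?thesis by (simp add: set_integrable_def)
  qed
qed

section \<open>The weakly singular operator on polynomial densities\<close>

text \<open>A fixed order \<open>s\<close> strictly between \<open>0\<close> and \<open>1\<close>.\<close>
locale fractional_order =
  fixes s :: real
  assumes s_pos: "0 < s" and s_less_1: "s < 1"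
begin

abbreviation "K \<equiv> frac_kernel s"
abbreviation "\<gamma> \<equiv> log_term s"
abbreviation "\<omega> \<equiv> weight (s - 1) 0 1"

lemma \<omega>_has_integral: "(\<omega> has_integral Beta s s) {0<..<1}"
  using has_integral_Beta_real[OF s_pos s_pos]
  by (simp add: has_integral_Icc_iff_Ioo weight_def[abs_def])

lemma set_integrable_\<omega>: "set_integrable lborel {0<..<1} \<omega>"
proof (rule set_integrable_lborel_nonneg)
  show "\<omega> integrable_on {0<..<1}" using \<omega>_has_integral by blast
qed (auto simp: weight_def set_borel_measurable_def)

lemma continuous_on_\<omega>: "continuous_on {0<..<1} \<omega>"
  unfolding weight_def[abs_def] by (intro continuous_intros) auto

lemma
  shows continuous_on_\<omega>_poly: "continuous_on {0<..<1} (\<lambda>y. \<omega> y * poly f y)"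
    and set_integrable_\<omega>_poly: "set_integrable lborel {0<..<1} (\<lambda>y. \<omega> y * poly f y)"
proof -
  show "continuous_on {0<..<1} (\<lambda>y. \<omega> y * poly f y)"
    by (intro continuous_intros continuous_on_\<omega>)
  have "compact (poly f ` {0..1})"
    by (intro compact_continuous_image continuous_intros) auto
  then obtain M where M: "\<forall>y\<in>{0..1}. norm (poly f y) \<le> M"
    using compact_imp_bounded bounded_iff by (metis image_eqI)
  have [measurable]: "poly f \<in> borel_measurable borel"
    by (intro borel_measurable_continuous_onI continuous_intros)
  show "set_integrable lborel {0<..<1} (\<lambda>y. \<omega> y * poly f y)"
  proof (rule set_integrable_bound[where f="\<lambda>y. M * \<omega> y"])
    show "set_integrable lborel {0<..<1} (\<lambda>y. M * \<omega> y)"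
      using set_integrable_\<omega> by (rule set_integrable_mult_right)
    show "set_borel_measurable lborel {0<..<1} (\<lambda>y. \<omega> y * poly f y)"
      by (auto simp: weight_def set_borel_measurable_def)
    have "norm (\<omega> y * poly f y) \<le> norm (M * \<omega> y)" if "y \<in> {0<..<1}" for y
    proof -
      have "\<bar>\<omega> y\<bar> * \<bar>poly f y\<bar> \<le> \<bar>\<omega> y\<bar> * \<bar>M\<bar>"
        using M that by (intro mult_left_mono) (auto intro: order_trans[OF _ abs_ge_self])
      then show ?thesis by (simp add: abs_mult mult.commute)
    qed
    then show "AE y in lborel. y \<in> {0<..<1} \<longrightarrow> norm (\<omega> y * poly f y) \<le> norm (M * \<omega> y)" by simp
  qed
qed

text \<open>The integral of a polynomial against \<open>\<omega>\<close>, which is the weight with exponent \<open>s - 1\<close>.\<close>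
definition moment :: "real poly \<Rightarrow> real" where
  "moment f = (LBINT y:{0<..<1}. \<omega> y * poly f y)"

text \<open>
  The weakly singular operator, and its companion \<open>G\<close> with the kernel \<open>z * K z\<close>, which is continuous.
\<close>
definition T :: "real poly \<Rightarrow> real \<Rightarrow> real" where
  "T f x = (LBINT y:{0<..<1}. K (x - y) * (\<omega> y * poly f y))"

definition G :: "real poly \<Rightarrow> real \<Rightarrow> real" where
  "G f x = (LBINT y:{0<..<1}. ((x - y) * K (x - y)) * (\<omega> y * poly f y))"

lemma T_integrable:
  assumes "x \<in> {0<..<1}"
  shows "set_integrable lborel {0<..<1} (\<lambda>y. K (x - y) * (\<omega> y * poly f y))"
  by (rule weakly_singular_convolution(1)[OF continuous_on_frac_kernel
        set_integrable_frac_kernel[OF s_less_1] set_integrable_\<omega>_poly continuous_on_\<omega>_poly assms])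

lemma G_integrable:
  assumes "x \<in> {0<..<1}"
  shows "set_integrable lborel {0<..<1} (\<lambda>y. ((x - y) * K (x - y)) * (\<omega> y * poly f y))"
  by (rule weakly_singular_convolution(1)[OF _ _ set_integrable_\<omega>_poly continuous_on_\<omega>_poly assms, where \<kappa>="\<lambda>z. z * K z"])
     (auto intro!: borel_integrable_atLeastAtMost' continuous_on_subset[OF continuous_on_times_frac_kernel[OF s_less_1]])

lemma T_add: "x \<in> {0<..<1} \<Longrightarrow> T (f + g) x = T f x + T g x"
  unfolding T_def poly_add distrib_left
  by (intro set_integral_add(2) T_integrable)

lemma T_smult: "T (smult c f) x = c * T f x"
  unfolding T_def by (subst set_integral_mult_right[symmetric]) (simp add: mult_ac)

lemma moment_add: "moment (f + g) = moment f + moment g"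
  unfolding moment_def poly_add distrib_left
  by (intro set_integral_add(2) set_integrable_\<omega>_poly)

lemma moment_smult: "moment (smult c f) = c * moment f"
  unfolding moment_def by (subst set_integral_mult_right[symmetric]) (simp add: mult_ac)

lemma G_eq:
  assumes "x \<in> {0<..<1}"
  shows "G f x = x * T f x - T ([:0, 1:] * f) x"
proof -
  have "x * T f x - T ([:0, 1:] * f) x = (LBINT y:{0<..<1}. x * (K (x - y) * (\<omega> y * poly f y)))
      - (LBINT y:{0<..<1}. K (x - y) * (\<omega> y * poly ([:0, 1:] * f) y))"
    by (simp only: T_def set_integral_mult_right)
  also have "\<dots> = (LBINT y:{0<..<1}. x * (K (x - y) * (\<omega> y * poly f y)) - K (x - y) * (\<omega> y * poly ([:0, 1:] * f) y))"
    using assms by (intro set_integral_diff(2)[symmetric] set_integrable_mult_right T_integrable)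
  also have "\<dots> = G f x"
    unfolding G_def by (intro set_lebesgue_integral_cong) (auto simp: algebra_simps)
  finally show ?thesis by simp
qed

lemma G_has_derivative:
  assumes x: "x \<in> {0<..<1}"
  shows "(G f has_real_derivative (2 - 2 * s) * T f x + \<gamma> * moment f) (at x)"
proof -
  have "(G f has_real_derivative (LBINT y:{0<..<1}. ((2 - 2 * s) * K (x - y) + \<gamma>) * (\<omega> y * poly f y))) (at x)"
    unfolding G_def[abs_def]
    using s_less_1 continuous_on_frac_kernel
    by (intro weakly_singular_convolution_deriv[where g="\<lambda>z. z * K z" and \<kappa>="\<lambda>z. (2 - 2 * s) * K z + \<gamma>"]
         continuous_on_times_frac_kernel times_frac_kernel_deriv set_integrable_\<omega>_poly continuous_on_\<omega>_poly x
         set_integral_add(1) set_integrable_mult_right set_integrable_frac_kernel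
         borel_integrable_atLeastAtMost' continuous_intros) auto
  also have "(LBINT y:{0<..<1}. ((2 - 2 * s) * K (x - y) + \<gamma>) * (\<omega> y * poly f y)) =
      (LBINT y:{0<..<1}. (2 - 2 * s) * (K (x - y) * (\<omega> y * poly f y)) + \<gamma> * (\<omega> y * poly f y))"
    by (intro set_lebesgue_integral_cong) (auto simp: algebra_simps)
  also have "\<dots> = (2 - 2 * s) * T f x + \<gamma> * moment f"
    unfolding T_def moment_def
    by (subst set_integral_add(2)) (auto intro!: T_integrable x set_integrable_mult_right set_integrable_\<omega>_poly)
  finally show ?thesis .
qed

text \<open>
  The polynomial \<open>W = x (1 - x)\<close>, and the first-order operator \<open>B f = W f' + s W' f\<close>, for which
  \<open>(W\<^sup>s f)' = W\<^sup>s\<^sup>-\<^sup>1 B f\<close>. The operator of the theorem is thus, up to its constant,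
  \<open>f \<mapsto> (T (B f))'\<close>.
\<close>
definition W :: "real poly" where "W = [:0, 1, -1:]"

definition B :: "real poly \<Rightarrow> real poly" where
  "B f = W * pderiv f + smult s ([:1, -2:] * f)"

lemma powr_reduce: "y > 0 \<Longrightarrow> y powr s = y * y powr (s - 1)"
  using powr_add[of y 1 "s - 1"] by simp

lemma weight_eq:
  assumes "y \<in> {0<..<1}"
  shows "weight s 0 1 y = \<omega> y * poly W y"
  using assms powr_reduce[of y] powr_reduce[of "1 - y"]
  by (simp add: weight_def W_def)

lemma weight_poly_deriv:
  assumes y: "y \<in> {0<..<1}"
  shows "((\<lambda>t. weight s 0 1 t * poly f t) has_real_derivative \<omega> y * poly (B f) y) (at y)"
proof -
  have "((\<lambda>t. (1 - t) powr s) has_real_derivative (s * (1 - y) powr (s - 1)) * (- 1)) (at y)"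
    by (rule DERIV_chain2[where f="\<lambda>t. t powr s"], rule has_real_derivative_powr)
       (use y in \<open>auto intro!: derivative_eq_intros\<close>)
  then have "((\<lambda>t. weight s 0 1 t * poly f t) has_real_derivative
     ((s * y powr (s - 1)) * (1 - y) powr s + ((s * (1 - y) powr (s - 1)) * (- 1)) * y powr s) * poly f y
       + poly (pderiv f) y * weight s 0 1 y) (at y)"
    unfolding weight_def diff_zero using y
    by (intro DERIV_mult has_real_derivative_powr poly_DERIV) auto
  moreover have "((s * y powr (s - 1)) * (1 - y) powr s + ((s * (1 - y) powr (s - 1)) * (- 1)) * y powr s) * poly f y
       + poly (pderiv f) y * weight s 0 1 y = \<omega> y * poly (B f) y"
    unfolding weight_eq[OF y]
    using y powr_reduce[of y] powr_reduce[of "1 - y"]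
    by (simp add: weight_def B_def) (simp add: algebra_simps)
  ultimately show ?thesis by simp
qed

lemma continuous_on_weight: "continuous_on {0..1} (weight s 0 1)"
  unfolding weight_def[abs_def] using s_pos by (intro continuous_intros continuous_on_powr') auto

section \<open>Integration by parts\<close>

text \<open>
  The boundary terms vanish in the next two lemmas because \<open>s > 0\<close>.
\<close>
lemma moment_B: "moment (B f) = 0"
proof -
  have "((\<lambda>y. \<omega> y * poly (B f) y) has_integral (weight s 0 1 1 * poly f 1 - weight s 0 1 0 * poly f 0)) {0..1}"
    by (rule fundamental_theorem_of_calculus_interior_strong[of "{}"])
       (auto simp: has_real_derivative_iff_has_vector_derivative[symmetric]
             intro!: weight_poly_deriv continuous_intros continuous_on_weight)
  then have "((\<lambda>y. \<omega> y * poly (B f) y) has_integral 0) {0<..<1}"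
    by (simp add: weight_def has_integral_Icc_iff_Ioo)
  then show ?thesis
    unfolding moment_def
    using set_borel_integral_eq_integral(2)[OF set_integrable_\<omega>_poly[of "B f"]]
    by (simp add: integral_unique)
qed

text \<open>
  Integration by parts for the kernel \<open>z * K z\<close>, which is continuous at \<open>z = 0\<close>, so that the point \<open>y = x\<close>
  contributes nothing. Its derivative in \<open>x\<close> says \<open>T (B f) = (T (W f))'\<close>.
\<close>
lemma G_B:
  assumes x: "x \<in> {0<..<1}"
  shows "G (B f) x = (2 - 2 * s) * T (W * f) x + \<gamma> * moment (W * f)"
proof -
  define h where "h y = ((x - y) * K (x - y)) * (\<omega> y * poly (B f) y) -
    ((2 - 2 * s) * (K (x - y) * (\<omega> y * poly (W * f) y)) + \<gamma> * (\<omega> y * poly (W * f) y))" for y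
  define F where "F y = ((x - y) * K (x - y)) * (weight s 0 1 y * poly f y)" for y
  have int1: "set_integrable lborel {0<..<1}
      (\<lambda>y. (2 - 2 * s) * (K (x - y) * (\<omega> y * poly (W * f) y)) + \<gamma> * (\<omega> y * poly (W * f) y))"
    by (intro set_integral_add(1) set_integrable_mult_right T_integrable set_integrable_\<omega>_poly x)
  have int: "set_integrable lborel {0<..<1} h"
    unfolding h_def by (intro set_integral_diff(1) int1 G_integrable x)
  have "(h has_integral (F 1 - F 0)) {0..1}"
  proof (rule fundamental_theorem_of_calculus_interior_strong[of "{x}"])
    fix y assume y: "y \<in> {0<..<1} - {x}"
    have "((\<lambda>y. (x - y) * K (x - y)) has_real_derivative ((2 - 2 * s) * K (x - y) + \<gamma>) * (- 1)) (at y)"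
      by (rule DERIV_chain2[where f="\<lambda>z. z * K z"], rule times_frac_kernel_deriv)
         (use y in \<open>auto intro!: derivative_eq_intros\<close>)
    from DERIV_mult[OF this weight_poly_deriv[of y f]] y
    have "(F has_real_derivative (((2 - 2 * s) * K (x - y) + \<gamma>) * (- 1)) * (weight s 0 1 y * poly f y)
       + (\<omega> y * poly (B f) y) * ((x - y) * K (x - y))) (at y)"
      by (simp add: F_def[abs_def])
    also have "(((2 - 2 * s) * K (x - y) + \<gamma>) * (- 1)) * (weight s 0 1 y * poly f y)
       + (\<omega> y * poly (B f) y) * ((x - y) * K (x - y)) = h y"
      using y by (simp add: h_def weight_eq algebra_simps)
    finally show "(F has_vector_derivative h y) (at y)"
      by (simp add: has_real_derivative_iff_has_vector_derivative)
  next
    show "continuous_on {0..1} F" unfolding F_def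
      by (intro continuous_intros continuous_on_weight
           continuous_on_compose2[OF continuous_on_times_frac_kernel[OF s_less_1]]) auto
  qed auto
  then have "(h has_integral 0) {0<..<1}"
    by (simp add: F_def weight_def has_integral_Icc_iff_Ioo)
  then have "(LBINT y:{0<..<1}. h y) = 0"
    using set_borel_integral_eq_integral(2)[OF int] by (simp add: integral_unique)
  also have "(LBINT y:{0<..<1}. h y) = G (B f) x - (LBINT y:{0<..<1}.
      (2 - 2 * s) * (K (x - y) * (\<omega> y * poly (W * f) y)) + \<gamma> * (\<omega> y * poly (W * f) y))"
    unfolding h_def G_def by (intro set_integral_diff(2) int1 G_integrable x)
  also have "(LBINT y:{0<..<1}.
      (2 - 2 * s) * (K (x - y) * (\<omega> y * poly (W * f) y)) + \<gamma> * (\<omega> y * poly (W * f) y)) =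
      (2 - 2 * s) * T (W * f) x + \<gamma> * moment (W * f)"
    unfolding T_def moment_def set_integral_mult_right[symmetric]
    by (intro set_integral_add(2) set_integrable_mult_right T_integrable set_integrable_\<omega>_poly x)
  finally show ?thesis by simp
qed

section \<open>The operator maps 1 to a constant\<close>

lemma T_reflect: "T 1 (1 - x) = T 1 x"
proof -
  have "T 1 (1 - x) = (\<integral>y. indicator {0<..<1} y * (K (1 - x - y) * \<omega> y) \<partial>lborel)"
    by (simp add: T_def set_lebesgue_integral_def)
  also have "\<dots> = (\<integral>y. indicator {0<..<1} (1 + - 1 * y) * (K (1 - x - (1 + - 1 * y)) * \<omega> (1 + - 1 * y)) \<partial>lborel)"
    using lborel_integral_real_affine[of "-1" "\<lambda>y. indicator {0<..<1} y * (K (1 - x - y) * \<omega> y)" 1]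
    by (simp add: indicator_def)
  also have "\<dots> = (\<integral>y. indicator {0<..<1} y * (K (x - y) * \<omega> y) \<partial>lborel)"
  proof (rule Bochner_Integration.integral_cong)
    fix y :: real
    have "K (y - x) = K (x - y)" using frac_kernel_minus[of s "x - y"] by simp
    then show "indicator {0<..<1} (1 + - 1 * y) * (K (1 - x - (1 + - 1 * y)) * \<omega> (1 + - 1 * y)) =
        indicator {0<..<1} y * (K (x - y) * \<omega> y)"
      by (auto simp: weight_def indicator_def mult.commute)
  qed simp
  also have "\<dots> = T 1 x" by (simp add: T_def set_lebesgue_integral_def)
  finally show ?thesis .
qed

text \<open>
  Write \<open>F\<^sub>k = T (x\<^sup>k)\<close>. The relation \<open>T (x f) = x T f - G f\<close> expresses \<open>F\<^sub>1\<close> and \<open>F\<^sub>2\<close> through \<open>F\<^sub>0\<close> and the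
  differentiable functions \<open>G 1\<close> and \<open>G x\<close>. Integration by parts for \<open>f = 1\<close> then gives \<open>W F\<^sub>0\<close> in terms of
  \<open>G 1\<close> and \<open>G x\<close>, so \<open>F\<^sub>0\<close> is differentiable. Differentiating once expresses \<open>F\<^sub>1\<close> through \<open>F\<^sub>0\<close> and
  \<open>a = F\<^sub>0'\<close>; differentiating again leaves the equation \<open>W a' + s W' a = 0\<close>. Hence \<open>W\<^sup>s a\<close> is constant,
  and it vanishes at \<open>1/2\<close> by the symmetry of \<open>F\<^sub>0\<close>.
\<close>
lemma T_1_const: "\<exists>c. \<forall>x\<in>{0<..<1}. T 1 x = c"
proof -
  define X :: "real poly" where "X = [:0, 1:]"
  define F0 F1 F2 where "F0 = T 1" and "F1 = T X" and "F2 = T (X * X)"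
  define m0 m1 c where "m0 = \<gamma> * moment 1" and "m1 = \<gamma> * moment X" and "c = \<gamma> * moment W"
  define \<beta> where "\<beta> = 2 - 2 * s"
  have \<beta>: "\<beta> > 0" using s_less_1 by (simp add: \<beta>_def)
  have G0: "G 1 x = x * F0 x - F1 x" "G X x = x * F1 x - F2 x" if "x \<in> {0<..<1}" for x
    using G_eq[OF that, of 1] G_eq[OF that, of X] by (simp_all add: F0_def F1_def F2_def X_def)
  have dG: "(G 1 has_real_derivative \<beta> * F0 x + m0) (at x)" "(G X has_real_derivative \<beta> * F1 x + m1) (at x)"
    if "x \<in> {0<..<1}" for x
    using G_has_derivative[OF that, of 1] G_has_derivative[OF that, of X]
    by (simp_all add: F0_def F1_def m0_def m1_def \<beta>_def)
  have eq: "s * x * F0 x - 2 * s * x * F1 x + 2 * F2 x - (2 - s) * F1 x = c" if x: "x \<in> {0<..<1}" for x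
  proof -
    have W: "W * 1 = X + smult (-1) (X * X)" "B 1 = smult s 1 + smult (-2 * s) X"
      "[:0, 1:] * B 1 = smult s X + smult (- 2 * s) (X * X)"
      by (simp_all add: W_def B_def X_def)
    have "x * T (B 1) x - T ([:0, 1:] * B 1) x = \<beta> * T (W * 1) x + c"
      using G_B[OF x, of 1] G_eq[OF x, of "B 1"] by (simp only: \<beta>_def c_def mult_1_right)
    moreover have "T (B 1) x = s * F0 x + (- 2 * s) * F1 x"
      unfolding W(2) by (simp only: T_add[OF x] T_smult F0_def F1_def)
    moreover have "T ([:0, 1:] * B 1) x = s * F1 x + (- 2 * s) * F2 x"
      unfolding W(3) by (simp only: T_add[OF x] T_smult F1_def F2_def)
    moreover have "T (W * 1) x = F1 x + (- 1) * F2 x"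
      unfolding W(1) by (simp only: T_add[OF x] T_smult F1_def F2_def)
    ultimately have "x * (s * F0 x + (- 2 * s) * F1 x) - (s * F1 x + (- 2 * s) * F2 x) = \<beta> * (F1 x + (- 1) * F2 x) + c"
      by simp
    then show ?thesis by (simp add: \<beta>_def algebra_simps)
  qed
  define N where "N x = c - 2 * s * x * G 1 x + 2 * x * G 1 x + 2 * G X x - (2 - s) * G 1 x" for x
  have F0_eq: "F0 x = N x / (- \<beta> * (x * (1 - x)))" if x: "x \<in> {0<..<1}" for x
  proof -
    have "N x = (- \<beta> * (x * (1 - x))) * F0 x"
      unfolding N_def G0[OF x] eq[OF x, symmetric] by (simp add: \<beta>_def algebra_simps)
    moreover have "- \<beta> * (x * (1 - x)) \<noteq> 0" using \<beta> x by auto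
    ultimately show ?thesis by simp
  qed
  define a where "a x = deriv F0 x" for x
  have dF0: "(F0 has_real_derivative a x) (at x)" if x: "x \<in> {0<..<1}" for x
  proof -
    have dN: "\<exists>d. (N has_real_derivative d) (at x)"
      unfolding N_def by (rule exI) (rule derivative_eq_intros dG[OF x] refl)+
    have nz: "- \<beta> * (x * (1 - x)) \<noteq> 0" using \<beta> x by auto
    obtain d where d: "(N has_real_derivative d) (at x)" using dN by blast
    have "\<exists>d. ((\<lambda>x. N x / (- \<beta> * (x * (1 - x)))) has_real_derivative d) (at x)"
      by (rule exI) (rule derivative_eq_intros d refl nz)+
    then obtain d' where "((\<lambda>x. N x / (- \<beta> * (x * (1 - x)))) has_real_derivative d') (at x)" by blast
    then have "(F0 has_real_derivative d') (at x)"
      by (rule has_field_derivative_transform_within_open[where S="{0<..<1}"]) (use x F0_eq in auto)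
    then show ?thesis unfolding a_def by (simp add: DERIV_imp_deriv)
  qed
  have trans: "(f has_real_derivative d) (at x)"
    if "(g has_real_derivative d) (at x)" "x \<in> {0<..<1}" "\<And>y. y \<in> {0<..<1} \<Longrightarrow> g y = f y" for f g d and x :: real
    by (rule has_field_derivative_transform_within_open[where S="{0<..<1}", OF that(1)]) (use that in auto)
  have dF1: "(F1 has_real_derivative F0 x + x * a x - (\<beta> * F0 x + m0)) (at x)" if x: "x \<in> {0<..<1}" for x
    by (rule trans[where g="\<lambda>x. x * F0 x - G 1 x"])
       (use x G0 in \<open>auto intro!: derivative_eq_intros dF0 dG\<close>)
  have dF2: "(F2 has_real_derivative F1 x + x * (F0 x + x * a x - (\<beta> * F0 x + m0)) - (\<beta> * F1 x + m1)) (at x)"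
    if x: "x \<in> {0<..<1}" for x
    by (rule trans[where g="\<lambda>x. x * F1 x - G X x"])
       (use x G0 in \<open>auto intro!: derivative_eq_intros dF1 dG\<close>)
  have mm: "m0 = 2 * m1"
  proof -
    have "B 1 = smult s 1 + smult (- 2 * s) X" by (simp add: B_def X_def)
    then have "s * moment 1 + (- 2 * s) * moment X = 0"
      using moment_B[of 1] by (simp only: moment_add moment_smult)
    then show ?thesis using s_pos by (simp add: m0_def m1_def)
  qed
  have F1_eq: "- F1 x = x * (1 - x) * a x + (1 - x) * ((2 * s - 1) * F0 x - m0) + m1 - s * F0 x"
    if x: "x \<in> {0<..<1}" for x
  proof -
    define d1 where "d1 = F0 x + x * a x - (\<beta> * F0 x + m0)"
    define d2 where "d2 = F1 x + x * d1 - (\<beta> * F1 x + m1)"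
    have d: "(F0 has_real_derivative a x) (at x)" "(F1 has_real_derivative d1) (at x)" "(F2 has_real_derivative d2) (at x)"
      using dF0[OF x] dF1[OF x] dF2[OF x] by (simp_all add: d1_def d2_def)
    have "((\<lambda>x. s * x * F0 x - 2 * s * x * F1 x + 2 * F2 x - (2 - s) * F1 x) has_real_derivative
        s * F0 x + s * x * a x - 2 * s * F1 x - 2 * s * x * d1 + 2 * d2 - (2 - s) * d1) (at x)"
      by (rule derivative_eq_intros d refl | simp)+
    moreover have "((\<lambda>x. s * x * F0 x - 2 * s * x * F1 x + 2 * F2 x - (2 - s) * F1 x) has_real_derivative 0) (at x)"
      by (rule trans[where g="\<lambda>x. c"]) (use x eq in auto)
    ultimately have "s * F0 x + s * x * a x - 2 * s * F1 x - 2 * s * x * d1 + 2 * d2 - (2 - s) * d1 = 0"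
      by (rule DERIV_unique)
    then have "\<beta> * (- F1 x) = \<beta> * (x * (1 - x) * a x + (1 - x) * ((2 * s - 1) * F0 x - m0) + m1 - s * F0 x)"
      unfolding d1_def d2_def \<beta>_def mm by (simp add: algebra_simps)
    then show ?thesis by (rule mult_left_cancel[THEN iffD1, rotated]) (use \<beta> in simp)
  qed
  \<comment> \<open>Solving the last equation for \<open>a\<close> shows that \<open>a\<close> is itself differentiable.\<close>
  define b where "b x = (- F1 x - (1 - x) * ((2 * s - 1) * F0 x - m0) - m1 + s * F0 x) / (x * (1 - x))" for x
  have ab: "b x = a x" if "x \<in> {0<..<1}" for x
    unfolding b_def F1_eq[OF that] using that by simp
  have da: "(a has_real_derivative - (s * (1 - 2 * x) * a x / (x * (1 - x)))) (at x)" if x: "x \<in> {0<..<1}" for x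
  proof -
    have "(b has_real_derivative
       ((- (F0 x + x * a x - (\<beta> * F0 x + m0)) + ((2 * s - 1) * F0 x - m0) - (1 - x) * (2 * s - 1) * a x + s * a x) * (x * (1 - x))
        - (- F1 x - (1 - x) * ((2 * s - 1) * F0 x - m0) - m1 + s * F0 x) * (1 - 2 * x)) / ((x * (1 - x)) * (x * (1 - x)))) (at x)"
      unfolding b_def
      by (rule DERIV_divide, (rule derivative_eq_intros dF0[OF x] dF1[OF x] refl | simp add: algebra_simps)+)
         (use x in auto)
    also have "(- F1 x - (1 - x) * ((2 * s - 1) * F0 x - m0) - m1 + s * F0 x) = x * (1 - x) * a x"
      unfolding F1_eq[OF x] by simp
    also have "((- (F0 x + x * a x - (\<beta> * F0 x + m0)) + ((2 * s - 1) * F0 x - m0) - (1 - x) * (2 * s - 1) * a x + s * a x) * (x * (1 - x))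
        - x * (1 - x) * a x * (1 - 2 * x)) = (x * (1 - x)) * (- (s * (1 - 2 * x) * a x))"
      by (simp add: \<beta>_def algebra_simps)
    also have "(x * (1 - x)) * (- (s * (1 - 2 * x) * a x)) / ((x * (1 - x)) * (x * (1 - x))) = - (s * (1 - 2 * x) * a x / (x * (1 - x)))"
      using x by simp
    finally show ?thesis by (rule trans) (use x ab in auto)
  qed
  have "\<exists>k. \<forall>x\<in>{0<..<1}. weight s 0 1 x * a x = k"
  proof (rule has_field_derivative_zero_constant)
    fix x :: real assume x: "x \<in> {0<..<1}"
    have "((\<lambda>x. weight s 0 1 x) has_real_derivative \<omega> x * (s * (1 - 2 * x))) (at x)"
      using weight_poly_deriv[OF x, of 1] by (simp add: B_def algebra_simps)
    from DERIV_mult[OF this da[OF x]]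
    have "((\<lambda>x. weight s 0 1 x * a x) has_real_derivative
      \<omega> x * (s * (1 - 2 * x)) * a x + - (s * (1 - 2 * x) * a x / (x * (1 - x))) * weight s 0 1 x) (at x)" .
    also have "\<omega> x * (s * (1 - 2 * x)) * a x + - (s * (1 - 2 * x) * a x / (x * (1 - x))) * weight s 0 1 x = 0"
    proof -
      have "x * (1 - x) = poly W x" by (simp add: W_def algebra_simps)
      moreover have "x * (1 - x) \<noteq> 0" using x by auto
      ultimately show ?thesis unfolding weight_eq[OF x] by simp
    qed
    finally show "((\<lambda>x. weight s 0 1 x * a x) has_real_derivative 0) (at x within {0<..<1})"
      by (rule has_field_derivative_at_within)
  qed auto
  then obtain k where k: "\<And>x. x \<in> {0<..<1} \<Longrightarrow> weight s 0 1 x * a x = k" by blast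
  have half: "a (1/2) = 0"
  proof -
    have "((\<lambda>x. F0 (1 - x)) has_real_derivative a (1/2) * (- 1)) (at (1/2))"
      by (rule DERIV_chain2[where f=F0]) (auto intro!: derivative_eq_intros dF0)
    then have "(F0 has_real_derivative - a (1/2)) (at (1/2))"
      by (simp add: F0_def T_reflect)
    from DERIV_unique[OF this dF0[of "1/2"]] show ?thesis by simp
  qed
  have a0: "a x = 0" if x: "x \<in> {0<..<1}" for x
    using k[OF x] k[of "1/2"] half x by (auto simp: weight_def)
  have "\<exists>c. \<forall>x\<in>{0<..<1}. F0 x = c"
  proof (rule has_field_derivative_zero_constant)
    fix x :: real assume x: "x \<in> {0<..<1}"
    show "(F0 has_real_derivative 0) (at x within {0<..<1})"
      using has_field_derivative_at_within[OF dF0[OF x]] a0[OF x] by simp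
  qed simp
  then show ?thesis by (simp add: F0_def)
qed

section \<open>Polynomials are mapped to polynomials\<close>

text \<open>
  Induction on \<open>f = a + x g\<close>: in \<open>T (x g) = x T g - G g\<close> the function \<open>G g\<close> has a polynomial derivative.
\<close>
lemma T_poly_exists: "\<exists>q. \<forall>x\<in>{0<..<1}. T f x = poly q x"
proof (induction f)
  case 0
  have "T 0 x = 0" for x by (simp add: T_def)
  then show ?case by (intro exI[of _ 0]) simp
next
  case (pCons a g)
  then obtain q where q: "\<And>x. x \<in> {0<..<1} \<Longrightarrow> T g x = poly q x" by blast
  obtain c where c: "\<And>x. x \<in> {0<..<1} \<Longrightarrow> T 1 x = c" using T_1_const by blast
  obtain r where r: "pderiv r = smult (2 - 2 * s) q + [:\<gamma> * moment g:]"
    using poly_antideriv_exists by blast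
  have "\<exists>k. \<forall>x\<in>{0<..<1}. G g x - poly r x = k"
  proof (rule has_field_derivative_zero_constant)
    fix x :: real assume x: "x \<in> {0<..<1}"
    have "((\<lambda>x. G g x - poly r x) has_real_derivative
        ((2 - 2 * s) * T g x + \<gamma> * moment g) - poly (pderiv r) x) (at x)"
      by (intro DERIV_diff G_has_derivative x poly_DERIV)
    then show "((\<lambda>x. G g x - poly r x) has_real_derivative 0) (at x within {0<..<1})"
      by (rule has_field_derivative_at_within[OF DERIV_cong]) (simp add: r q[OF x])
  qed simp
  then obtain k where k: "\<And>x. x \<in> {0<..<1} \<Longrightarrow> G g x - poly r x = k" by blast
  have f: "pCons a g = smult a 1 + [:0, 1:] * g" by simp
  have "T (pCons a g) x = poly ([:a * c - k:] + [:0, 1:] * q - r) x" if x: "x \<in> {0<..<1}" for x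
  proof -
    have "T (pCons a g) x = a * T 1 x + T ([:0, 1:] * g) x"
      unfolding f by (simp only: T_add[OF x] T_smult)
    moreover have "T ([:0, 1:] * g) x = x * T g x - G g x" using G_eq[OF x, of g] by simp
    moreover have "G g x = k + poly r x" using k[OF x] by linarith
    ultimately show ?thesis by (simp add: c[OF x] q[OF x] algebra_simps)
  qed
  then show ?case by (intro exI[of _ "[:a * c - k:] + [:0, 1:] * q - r"] ballI)
qed

text \<open>The unique polynomial that agrees with \<open>T f\<close> on \<open>(0, 1)\<close>.\<close>
definition T_poly :: "real poly \<Rightarrow> real poly" where
  "T_poly f = (SOME q. \<forall>x\<in>{0<..<1}. T f x = poly q x)"

lemma T_eq_poly: "x \<in> {0<..<1} \<Longrightarrow> T f x = poly (T_poly f) x"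
  unfolding T_poly_def by (rule someI_ex[OF T_poly_exists, THEN bspec])

text \<open>The derivative \<open>A f = (T f)'\<close>, as an operator on polynomials.\<close>
definition A :: "real poly \<Rightarrow> real poly" where
  "A f = pderiv (T_poly f)"

lemma T_poly_add: "T_poly (f + g) = T_poly f + T_poly g"
  by (rule poly_eqI_Ioo) (simp add: T_eq_poly[symmetric] T_add)

lemma T_poly_smult: "T_poly (smult c f) = smult c (T_poly f)"
  by (rule poly_eqI_Ioo) (simp add: T_eq_poly[symmetric] T_smult)

lemma A_add: "A (f + g) = A f + A g"
  by (simp add: A_def T_poly_add pderiv_add)

lemma A_smult: "A (smult c f) = smult c (A f)"
  by (simp add: A_def T_poly_smult pderiv_smult)

lemma A_diff: "A (f - g) = A f - A g"
proof -
  have "f - g = f + smult (-1) g" by simp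
  then have "A (f - g) = A f + smult (-1) (A g)" by (simp only: A_add A_smult)
  then show ?thesis by simp
qed

lemma T_has_derivative:
  assumes x: "x \<in> {0<..<1}"
  shows "(T f has_real_derivative poly (A f) x) (at x)"
  unfolding A_def
  by (rule has_field_derivative_transform_within_open[OF poly_DERIV, where S="{0<..<1}"])
     (use x T_eq_poly in auto)

lemma A_times_X_aux: "A ([:0, 1:] * f) = [:0, 1:] * A f + smult (2 * s - 1) (T_poly f) - [:\<gamma> * moment f:]"
proof (rule poly_eqI_Ioo)
  fix x :: real assume x: "x \<in> {0<..<1}"
  have "((\<lambda>x. x * T f x - G f x) has_real_derivative
      1 * T f x + poly (A f) x * x - ((2 - 2 * s) * T f x + \<gamma> * moment f)) (at x)"
    by (intro DERIV_diff DERIV_mult DERIV_ident T_has_derivative G_has_derivative x)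
  then have "(T ([:0, 1:] * f) has_real_derivative
      1 * T f x + poly (A f) x * x - ((2 - 2 * s) * T f x + \<gamma> * moment f)) (at x)"
    by (rule has_field_derivative_transform_within_open[where S="{0<..<1}"]) (use x G_eq in auto)
  from DERIV_unique[OF this T_has_derivative[OF x]]
  show "poly (A ([:0, 1:] * f)) x = poly ([:0, 1:] * A f + smult (2 * s - 1) (T_poly f) - [:\<gamma> * moment f:]) x"
    by (simp add: T_eq_poly[OF x] algebra_simps)
qed

section \<open>Commutation relations\<close>

lemma pderiv_A_times_X: "pderiv (A ([:0, 1:] * f)) = [:0, 1:] * pderiv (A f) + smult (2 * s) (A f)"
proof -
  have "pderiv (A ([:0, 1:] * f)) = pderiv ([:0, 1:] * A f) + smult (2 * s - 1) (A f)"
    unfolding A_times_X_aux by (simp add: pderiv_add pderiv_diff pderiv_smult A_def)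
  also have "pderiv ([:0, 1:] * A f) = [:0, 1:] * pderiv (A f) + A f"
    by (subst pderiv_mult) (simp add: pderiv_pCons)
  finally show ?thesis by (rule trans) (rule poly_eqI, simp add: algebra_simps)
qed

lemma pderiv_A_times_W: "pderiv (A (W * f)) = A (B f)"
proof -
  have "T_poly (B f) = A (W * f)"
  proof (rule poly_eqI_Ioo)
    fix x :: real assume x: "x \<in> {0<..<1}"
    have "((\<lambda>x. (2 - 2 * s) * T (W * f) x + \<gamma> * moment (W * f)) has_real_derivative
       (2 - 2 * s) * poly (A (W * f)) x + 0) (at x)"
      by (intro DERIV_add DERIV_cmult DERIV_const T_has_derivative x)
    then have "(G (B f) has_real_derivative (2 - 2 * s) * poly (A (W * f)) x + 0) (at x)"
      by (rule has_field_derivative_transform_within_open[where S="{0<..<1}"]) (use x G_B in auto)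
    from DERIV_unique[OF this G_has_derivative[OF x]] s_less_1
    show "poly (T_poly (B f)) x = poly (A (W * f)) x"
      by (simp add: moment_B T_eq_poly[OF x])
  qed
  then show ?thesis by (simp add: A_def)
qed

lemma A_1: "A 1 = 0"
proof -
  obtain c where c: "\<And>x. x \<in> {0<..<1} \<Longrightarrow> T 1 x = c" using T_1_const by blast
  have "T_poly 1 = [:c:]" by (rule poly_eqI_Ioo) (simp add: T_eq_poly[symmetric] c)
  then show ?thesis by (simp add: A_def pderiv_pCons)
qed

text \<open>
  Two expansions of \<open>(A (W f))'\<close> are compared: \<open>pderiv_A_times_W\<close>, and \<open>pderiv_A_times_X\<close> applied to
  \<open>W f = x (f - x f)\<close>.
\<close>
lemma A_W_pderiv: "A (W * pderiv f) = B (A f)"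
proof -
  define X :: "real poly" where "X = [:0, 1:]"
  have Wf: "W * f = X * (f - X * f)" by (simp add: W_def X_def algebra_simps)
  have Bf: "B f = W * pderiv f + smult s f - smult (2 * s) (X * f)"
    by (rule poly_eqI_Ioo) (simp add: B_def X_def algebra_simps)
  have "A (W * pderiv f) + smult s (A f) - smult (2 * s) (A (X * f)) = A (B f)"
    unfolding Bf by (simp only: A_add A_diff A_smult)
  also have "\<dots> = pderiv (A (X * (f - X * f)))"
    unfolding Wf[symmetric] by (simp only: pderiv_A_times_W)
  also have "\<dots> = X * (pderiv (A f) - (X * pderiv (A f) + smult (2 * s) (A f)))
     + smult (2 * s) (A f - A (X * f))"
    unfolding X_def by (simp only: pderiv_A_times_X A_diff pderiv_diff)
  finally have "A (W * pderiv f) = X * (pderiv (A f) - (X * pderiv (A f) + smult (2 * s) (A f)))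
     + smult (2 * s) (A f - A (X * f)) + smult (2 * s) (A (X * f)) - smult s (A f)"
    by (simp add: algebra_simps)
  also have "\<dots> = B (A f)"
    by (rule poly_eqI_Ioo) (simp add: B_def W_def X_def algebra_simps)
  finally show ?thesis .
qed

text \<open>
  The operator \<open>A B\<close> commutes with \<open>f \<mapsto> (B f)'\<close>, whose eigenfunctions are the Gegenbauer polynomials.
\<close>
lemma AB_commutes: "pderiv (B (A (B f))) = A (B (pderiv (B f)))"
  by (simp only: A_W_pderiv[symmetric] pderiv_A_times_W)

section \<open>Leading coefficients\<close>

lemma coeff_B:
  assumes "degree q \<le> j"
  shows "coeff (B q) (Suc j) = - (real j + 2 * s) * coeff q j" "degree (B q) \<le> Suc j"
proof -
  have Bq: "B q = [:0, 1:] * pderiv q - [:0, 1:] * ([:0, 1:] * pderiv q) + smult s q - smult (2 * s) ([:0, 1:] * q)"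
    by (rule poly_eqI_Ioo) (simp add: B_def W_def algebra_simps)
  have c: "coeff ([:0, 1:] * r) (Suc i) = coeff r i" "coeff ([:0, 1:] * r) 0 = 0" for r :: "real poly" and i
    by simp_all
  have 0: "coeff q i = 0" if "i > j" for i using assms that by (intro coeff_eq_0) simp
  show "coeff (B q) (Suc j) = - (real j + 2 * s) * coeff q j"
    unfolding Bq using 0[of "Suc j"]
    by (cases j) (simp_all add: coeff_pderiv algebra_simps)
  show "degree (B q) \<le> Suc j"
  proof (rule degree_le, intro allI impI)
    fix i assume "Suc j < i"
    then obtain k where k: "i = Suc (Suc k)" "j \<le> k" by (metis Suc_less_eq2 less_imp_Suc_add le_add1 Suc_lessE less_Suc_eq_le)
    show "coeff (B q) i = 0"
      unfolding Bq k using 0[of "Suc k"] 0[of "Suc (Suc k)"] k(2)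
      by (simp add: coeff_pderiv)
  qed
qed

lemma A_X: "A [:0, 1:] = [:coeff (A [:0, 1:]) 0:]"
proof -
  have "pderiv (A [:0, 1:]) = 0" using pderiv_A_times_X[of 1] by (simp add: A_1)
  then have "degree (A [:0, 1:]) = 0" by (simp add: pderiv_eq_0_iff)
  then show ?thesis by (metis degree_0_id)
qed

text \<open>
  The constant \<open>A x\<close> is carried along as \<open>coeff (A [:0, 1:]) 0\<close>; the relation \<open>pderiv_A_times_X\<close>
  multiplies the leading coefficient by \<open>(n + 2 s) / (n + 1)\<close> at each step.
\<close>
lemma coeff_A:
  assumes "degree f \<le> Suc n"
  shows "degree (A f) \<le> n \<and> coeff (A f) n = coeff (A [:0, 1:]) 0 * pochhammer (2 * s) n / fact n * coeff f (Suc n)"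
  using assms
proof (induction n arbitrary: f)
  case 0
  obtain c g where f: "f = pCons c g" by (cases f)
  with 0 have "degree g = 0" by (simp split: if_splits)
  then obtain d where "g = [:d:]" by (metis degree_0_id)
  then have fd: "f = smult c 1 + smult d [:0, 1:]" "coeff f (Suc 0) = d" by (simp_all add: f)
  have "A f = smult d (A [:0, 1:])" unfolding fd(1) by (simp only: A_add A_smult A_1 smult_0_right add_0)
  also have "\<dots> = [:d * coeff (A [:0, 1:]) 0:]" by (subst A_X) simp
  finally show ?case by (simp add: fd(2))
next
  case (Suc n)
  obtain c g where f: "f = pCons c g" by (cases f)
  with Suc.prems have g: "degree g \<le> Suc n" by (simp split: if_splits)
  have "A f = A (smult c 1 + [:0, 1:] * g)" by (simp add: f)
  then have Af: "A f = A ([:0, 1:] * g)" by (simp only: A_add A_smult A_1 smult_0_right add_0)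
  note IH = Suc.IH[OF g]
  have D: "pderiv (A f) = [:0, 1:] * pderiv (A g) + smult (2 * s) (A g)"
    unfolding Af by (rule pderiv_A_times_X)
  have c: "coeff (pderiv (A f)) i = (real i + 2 * s) * coeff (A g) i" for i
    unfolding D by (cases i) (simp_all add: coeff_pderiv algebra_simps)
  have "degree (A f) \<le> Suc n"
  proof (rule degree_le, intro allI impI)
    fix i assume i: "Suc n < i"
    then obtain k where k: "i = Suc k" "n < k" by (auto elim: Suc_lessE)
    have "coeff (pderiv (A f)) k = 0" unfolding c using IH k(2) by (simp add: coeff_eq_0)
    then show "coeff (A f) i = 0" by (simp add: k coeff_pderiv)
  qed
  moreover have "real (Suc n) * coeff (A f) (Suc n) = (real n + 2 * s) * coeff (A g) n"
    using c[of n] by (simp add: coeff_pderiv)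
  then have "coeff (A f) (Suc n) = (real n + 2 * s) * coeff (A g) n / real (Suc n)"
    by (simp add: field_simps)
  ultimately show ?case using IH by (simp add: f pochhammer_Suc field_simps)
qed

text \<open>
  The numbers \<open>(j + 1) (j + 2 s)\<close> are distinct, so an eigenpolynomial for the index \<open>n\<close> cannot have
  degree below \<open>n\<close>.
\<close>
lemma eigenpoly_zero:
  assumes eig: "pderiv (B q) = smult (- (real n + 1) * (real n + 2 * s)) q"
    and deg: "degree q \<le> n" and lead: "coeff q n = 0"
  shows "q = 0"
proof (rule ccontr)
  assume "q \<noteq> 0"
  define j where "j = degree q"
  have lj: "coeff q j \<noteq> 0" using \<open>q \<noteq> 0\<close> by (simp add: j_def)
  have jn: "j < n" using deg lead lj by (cases "j = n") (auto simp: j_def)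
  have "coeff (pderiv (B q)) j = (real j + 1) * (- (real j + 2 * s) * coeff q j)"
    using coeff_B(1)[of q j] by (simp add: coeff_pderiv j_def)
  moreover have "coeff (pderiv (B q)) j = - (real n + 1) * (real n + 2 * s) * coeff q j"
    unfolding eig by (simp only: coeff_smult)
  ultimately have "((real j + 1) * (real j + 2 * s) - (real n + 1) * (real n + 2 * s)) * coeff q j = 0"
    by (simp add: algebra_simps)
  with lj have "(real j + 1) * (real j + 2 * s) = (real n + 1) * (real n + 2 * s)" by simp
  moreover have "(real j + 1) * (real j + 2 * s) < (real n + 1) * (real n + 2 * s)"
    using jn s_pos by (intro mult_strict_mono) auto
  ultimately show False by simp
qed

section \<open>Gegenbauer polynomials as eigenfunctions\<close>

text \<open>The Gegenbauer polynomial with parameter \<open>s + 1/2\<close> at the argument \<open>2 x - 1\<close>, as a polynomial in \<open>x\<close>.\<close>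
fun gegenbauer_poly :: "nat \<Rightarrow> real poly" where
  "gegenbauer_poly 0 = 1"
| "gegenbauer_poly (Suc 0) = smult (2 * s + 1) [:-1, 2:]"
| "gegenbauer_poly (Suc (Suc k)) =
     smult (2 * (real k + s + 3/2) / real (k + 2)) ([:-1, 2:] * gegenbauer_poly (Suc k))
     - smult ((real k + 2 * s + 1) / real (k + 2)) (gegenbauer_poly k)"

lemma poly_gegenbauer_poly: "poly (gegenbauer_poly n) x = gegenbauer (s + 1/2) n (2 * x - 1)"
proof (induction n rule: gegenbauer_poly.induct)
  case (3 k)
  then show ?case by (simp add: divide_simps) (simp add: algebra_simps)
qed (simp_all add: algebra_simps)

lemma degree_gegenbauer_poly: "degree (gegenbauer_poly n) \<le> n"
proof (induction n rule: gegenbauer_poly.induct)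
  case (3 k)
  have "degree ([:-1, 2:] * gegenbauer_poly (Suc k)) \<le> Suc (Suc k)"
    using degree_mult_le[of "[:-1, 2::real:]" "gegenbauer_poly (Suc k)"] 3 by simp
  with 3 show ?case by (auto intro!: degree_diff_le order_trans[OF degree_smult_le])
qed auto

text \<open>
  The two classical contiguous relations for the derivatives. They are proved by a joint induction.
\<close>
lemma pderiv_gegenbauer_poly:
  fixes x :: real and n :: nat
  defines "t \<equiv> 2 * x - 1"
  defines "g \<equiv> (\<lambda>n. poly (gegenbauer_poly n) x)"
  defines "d \<equiv> (\<lambda>n. poly (pderiv (gegenbauer_poly n)) x)"
  shows "d (Suc n) = t * d n + 2 * (real n + 2 * s + 1) * g n"
    and "t * d (Suc n) - d n = 2 * (real n + 1) * g (Suc n)"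
proof -
  have g2: "(real n + 2) * g (Suc (Suc n)) = 2 * (real n + s + 3/2) * t * g (Suc n) - (real n + 2 * s + 1) * g n" for n
    by (simp add: g_def t_def divide_simps) (simp add: algebra_simps)
  have d2: "(real n + 2) * d (Suc (Suc n)) =
      2 * (real n + s + 3/2) * (t * d (Suc n) + 2 * g (Suc n)) - (real n + 2 * s + 1) * d n" for n
    by (simp add: g_def d_def t_def pderiv_diff pderiv_smult pderiv_mult pderiv_pCons divide_simps del: mult_pCons_left)
       (simp add: algebra_simps)
  have "d (Suc n) = t * d n + 2 * (real n + 2 * s + 1) * g n \<and>
        t * d (Suc n) - d n = 2 * (real n + 1) * g (Suc n)" for n
  proof (induction n)
    case 0
    show ?case by (simp add: g_def d_def t_def pderiv_pCons algebra_simps)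
  next
    case (Suc n)
    then have R: "d (Suc n) = t * d n + 2 * (real n + 2 * s + 1) * g n"
      and S: "d n = t * d (Suc n) - 2 * (real n + 1) * g (Suc n)" by auto
    have "(real n + 2) * d (Suc (Suc n)) = (real n + 2) * (t * d (Suc n) + 2 * (real (Suc n) + 2 * s + 1) * g (Suc n))"
      unfolding d2 S by (simp add: algebra_simps)
    then have R': "d (Suc (Suc n)) = t * d (Suc n) + 2 * (real (Suc n) + 2 * s + 1) * g (Suc n)"
      by (rule mult_left_cancel[THEN iffD1, rotated]) simp
    have E: "(1 - t * t) * d (Suc n) = 2 * (real n + 2 * s + 1) * g n - 2 * (real n + 1) * t * g (Suc n)"
      using R unfolding S by (simp add: algebra_simps)
    have "t * d (Suc (Suc n)) - d (Suc n) = 2 * (real (Suc n) + 2 * s + 1) * t * g (Suc n) - (1 - t * t) * d (Suc n)"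
      unfolding R' by (simp add: algebra_simps)
    also have "\<dots> = 2 * ((real n + 2) * g (Suc (Suc n)))"
      unfolding E g2 by (simp add: algebra_simps)
    finally show ?case using R' by simp
  qed
  then show "d (Suc n) = t * d n + 2 * (real n + 2 * s + 1) * g n"
    and "t * d (Suc n) - d n = 2 * (real n + 1) * g (Suc n)" by blast+
qed

text \<open>The Gegenbauer differential equation, in terms of \<open>B\<close>.\<close>
lemma gegenbauer_poly_eigen:
  "pderiv (B (gegenbauer_poly n)) = smult (- (real n + 1) * (real n + 2 * s)) (gegenbauer_poly n)"
proof (cases n)
  case 0
  then show ?thesis by (simp add: B_def pderiv_pCons)
next
  case (Suc k)
  have B: "B (gegenbauer_poly (Suc k)) =
      smult (- (real k + 2 * s + 1) / 2) ([:-1, 2:] * gegenbauer_poly (Suc k) - gegenbauer_poly k)"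
  proof (rule poly_eqI_Ioo)
    fix x :: real
    define t g d where "t = 2 * x - 1" and "g = (\<lambda>n. poly (gegenbauer_poly n) x)"
      and "d = (\<lambda>n. poly (pderiv (gegenbauer_poly n)) x)"
    have R: "d (Suc k) = t * d k + 2 * (real k + 2 * s + 1) * g k"
      and S: "d k = t * d (Suc k) - 2 * (real k + 1) * g (Suc k)"
      using pderiv_gegenbauer_poly[where x=x and n=k] by (auto simp: t_def g_def d_def)
    have E: "(1 - t * t) * d (Suc k) = 2 * (real k + 2 * s + 1) * g k - 2 * (real k + 1) * t * g (Suc k)"
      using R unfolding S by (simp add: algebra_simps)
    have "4 * poly (B (gegenbauer_poly (Suc k))) x = (1 - t * t) * d (Suc k) - 4 * s * t * g (Suc k)"
      by (simp add: B_def W_def t_def g_def d_def algebra_simps)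
    also have "\<dots> = 4 * (- (real k + 2 * s + 1) / 2 * (t * g (Suc k) - g k))"
      unfolding E by (simp add: field_simps)
    finally have "poly (B (gegenbauer_poly (Suc k))) x = - (real k + 2 * s + 1) / 2 * (t * g (Suc k) - g k)"
      by (rule mult_left_cancel[THEN iffD1, rotated]) simp
    then show "poly (B (gegenbauer_poly (Suc k))) x =
       poly (smult (- (real k + 2 * s + 1) / 2) ([:-1, 2:] * gegenbauer_poly (Suc k) - gegenbauer_poly k)) x"
      by (simp only: t_def g_def poly_smult poly_diff poly_mult) (simp add: algebra_simps)
  qed
  show ?thesis
  proof (rule poly_eqI_Ioo)
    fix x :: real
    have "poly (pderiv (B (gegenbauer_poly (Suc k)))) x =
       - (real k + 2 * s + 1) / 2 * (2 * poly (gegenbauer_poly (Suc k)) x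
          + ((2 * x - 1) * poly (pderiv (gegenbauer_poly (Suc k))) x - poly (pderiv (gegenbauer_poly k)) x))"
      unfolding B by (simp add: pderiv_diff pderiv_smult pderiv_mult pderiv_pCons del: mult_pCons_left gegenbauer_poly.simps)
    also have "\<dots> = - (real k + 2) * (real k + 2 * s + 1) * poly (gegenbauer_poly (Suc k)) x"
      unfolding pderiv_gegenbauer_poly(2) by (simp add: field_simps del: gegenbauer_poly.simps)
    finally show "poly (pderiv (B (gegenbauer_poly n))) x =
        poly (smult (- (real n + 1) * (real n + 2 * s)) (gegenbauer_poly n)) x"
      unfolding Suc by (simp add: algebra_simps del: gegenbauer_poly.simps)
  qed
qed

lemma A_B_gegenbauer_poly:
  "A (B (gegenbauer_poly n)) =
     smult (- coeff (A [:0, 1:]) 0 * pochhammer (2 * s) (Suc n) / fact n) (gegenbauer_poly n)"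
proof -
  define p where "p = gegenbauer_poly n"
  define c where "c = - coeff (A [:0, 1:]) 0 * pochhammer (2 * s) (Suc n) / fact n"
  have p: "degree p \<le> n" "pderiv (B p) = smult (- (real n + 1) * (real n + 2 * s)) p"
    unfolding p_def by (rule degree_gegenbauer_poly gegenbauer_poly_eigen)+
  have B_smult: "B (smult r f) = smult r (B f)" for r f
    by (rule poly_eqI_Ioo) (simp add: B_def pderiv_smult algebra_simps)
  have B_diff: "B (f - g) = B f - B g" for f g
    by (rule poly_eqI_Ioo) (simp add: B_def pderiv_diff algebra_simps)
  have "A (B p) - smult c p = 0"
  proof (rule eigenpoly_zero)
    have "pderiv (B (A (B p))) = smult (- (real n + 1) * (real n + 2 * s)) (A (B p))"
      unfolding AB_commutes p(2) by (simp only: B_smult A_smult)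
    then show "pderiv (B (A (B p) - smult c p)) = smult (- (real n + 1) * (real n + 2 * s)) (A (B p) - smult c p)"
      by (simp only: B_diff B_smult pderiv_diff pderiv_smult p(2) smult_diff_right smult_smult mult.commute)
    note AB = coeff_A[OF coeff_B(2)[OF p(1)]]
    show "degree (A (B p) - smult c p) \<le> n"
      using AB p(1) by (intro degree_diff_le order_trans[OF degree_smult_le]) auto
    show "coeff (A (B p) - smult c p) n = 0"
      using AB coeff_B(1)[OF p(1)] by (simp add: c_def pochhammer_Suc field_simps)
  qed
  then show ?thesis by (simp add: p_def c_def)
qed

section \<open>The constant\<close>

text \<open>
  The integrand is symmetric about \<open>1/2\<close>, and on the right half the substitution \<open>r = (2 y - 1)\<^sup>2\<close> turns
  it into the integrand of a Beta integral.
\<close>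
lemma T_1_half:
  assumes "s \<noteq> 1/2"
  shows "T 1 (1/2) = Beta (1 - s) s"
proof -
  define f where "f r = r powr ((1 - s) - 1) * (1 - r) powr (s - 1)" for r :: real
  define F where "F y = \<bar>1/2 - y\<bar> powr (1 - 2 * s) * \<omega> y" for y
  have f_int: "(f has_integral Beta (1 - s) s) {0..1}"
    unfolding f_def using has_integral_Beta_real[of "1 - s" s] s_pos s_less_1 by simp
  have f_leb: "set_integrable lborel {0..1} f"
    by (rule set_integrable_lborel_nonneg) (use f_int in \<open>auto simp: f_def set_borel_measurable_def\<close>)
  then have f_val: "(LBINT r:{0..1}. f r) = Beta (1 - s) s"
    using set_borel_integral_eq_integral(2) f_int by (metis integral_unique)
  have F_int: "set_integrable lborel {0<..<1} F"
    using T_integrable[of "1/2" 1] assms by (simp add: F_def[abs_def] frac_kernel_def)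
  have der: "((\<lambda>y. (2 * y - 1)\<^sup>2) has_real_derivative 4 * (2 * y - 1)) (at y)" for y :: real
    by (auto intro!: derivative_eq_intros)
  have reflect: "(LBINT y. indicator {1/2<..<1} y * F y) = (LBINT y. indicator {0<..<1/2} y * F y)"
  proof -
    have "indicator {1/2<..<1} (1 + - 1 * y) * F (1 + - 1 * y) = indicator {0<..<1/2} y * F y" for y
      by (auto simp: F_def weight_def indicator_def abs_minus_commute mult.commute)
    then show ?thesis
      using lborel_integral_real_affine[of "-1" "\<lambda>y. indicator {1/2<..<1} y * F y" 1] by simp
  qed
  have "(LBINT r. f r * indicator {(2 * (1/2) - 1)\<^sup>2..(2 * 1 - 1)\<^sup>2} r) =
      (LBINT y. f ((2 * y - 1)\<^sup>2) * (4 * (2 * y - 1)) * indicator {1/2..1} y)"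
  proof (rule integral_substitution[where g="\<lambda>y. (2 * y - 1)\<^sup>2" and g'="\<lambda>y. 4 * (2 * y - 1)"])
    show "set_integrable lborel {(2 * (1/2) - 1)\<^sup>2..(2 * 1 - 1 :: real)\<^sup>2} f" using f_leb by simp
  qed (rule der | intro continuous_intros | simp)+
  then have "Beta (1 - s) s = (LBINT y. f ((2 * y - 1)\<^sup>2) * (4 * (2 * y - 1)) * indicator {1/2..1} y)"
    using f_val by (simp add: set_lebesgue_integral_def mult.commute)
  also have "\<dots> = (LBINT y. 2 * (indicator {1/2<..<1} y * F y))"
  proof (rule integral_cong_AE)
    have "AE y in lborel. y \<noteq> 1/2 \<and> y \<noteq> (1::real)"
      using AE_lborel_singleton[of "1/2::real"] AE_lborel_singleton[of "1::real"] by eventually_elim auto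
    then show "AE y in lborel. f ((2 * y - 1)\<^sup>2) * (4 * (2 * y - 1)) * indicator {1/2..1} y = 2 * (indicator {1/2<..<1} y * F y)"
    proof eventually_elim
      case (elim y)
      show ?case
      proof (cases "y \<in> {1/2<..<1}")
        case True
        define v where "v = 2 * y - 1"
        have v: "0 < v" "v < 1" using True by (auto simp: v_def)
        have 1: "(v\<^sup>2) powr ((1 - s) - 1) * v = v powr (1 - 2 * s)"
        proof -
          have "(v\<^sup>2) powr ((1 - s) - 1) = v powr (- (2 * s))"
            using v by (simp add: powr_powr flip: powr_numeral)
          then show ?thesis using v powr_add[of v "- (2 * s)" 1] by (simp add: add.commute)
        qed
        have 2: "(1 - v\<^sup>2) powr (s - 1) = 4 powr (s - 1) * \<omega> y"
        proof -
          have "1 - v\<^sup>2 = 4 * (y * (1 - y))" by (simp add: v_def power2_eq_square algebra_simps)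
          then show ?thesis using True by (simp add: weight_def powr_mult)
        qed
        have 3: "\<bar>1/2 - y\<bar> powr (1 - 2 * s) = v powr (1 - 2 * s) * 2 powr (2 * s - 1)"
        proof -
          have "\<bar>1/2 - y\<bar> = v * (1/2)" using True by (simp add: v_def)
          moreover have "(1/2) powr (1 - 2 * s) = 2 powr (2 * s - 1)"
            by (simp add: powr_divide powr_minus_divide[symmetric])
          ultimately show ?thesis using v by (simp only: powr_mult)
        qed
        have 4: "4 powr (s - 1) * 4 = 2 * 2 powr (2 * s - 1)"
        proof -
          have "(4::real) powr (s - 1) = (2 powr 2) powr (s - 1)" by simp
          also have "\<dots> = 2 powr (2 * s - 2)" by (simp only: powr_powr) (simp add: algebra_simps)
          finally have "(4::real) powr (s - 1) * 4 = 2 powr (2 * s - 2) * 2 powr 1 * 2" by simp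
          also have "\<dots> = 2 powr (2 * s - 1) * 2" by (simp only: powr_add[symmetric]) simp
          finally show ?thesis by simp
        qed
        have "f (v\<^sup>2) * (4 * v) = ((v\<^sup>2) powr ((1 - s) - 1) * v) * (1 - v\<^sup>2) powr (s - 1) * 4"
          by (simp only: f_def mult_ac)
        also have "\<dots> = v powr (1 - 2 * s) * \<omega> y * (4 powr (s - 1) * 4)"
          unfolding 1 2 by (simp only: mult_ac)
        also have "\<dots> = 2 * F y" unfolding 4 F_def 3 by (simp only: mult_ac)
        finally show ?thesis using True by (simp add: v_def)
      qed (use elim in \<open>auto simp: indicator_def\<close>)
    qed
  qed (auto simp: f_def F_def weight_def)
  also have "\<dots> = (LBINT y. indicator {0<..<1/2} y * F y) + (LBINT y. indicator {1/2<..<1} y * F y)"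
    using reflect by simp
  also have "\<dots> = (LBINT y:{0<..<1}. F y)"
  proof -
    have sub: "set_integrable lborel S F" if "S \<subseteq> {0<..<1}" "S \<in> sets borel" for S
      using set_integrable_subset[OF F_int] that by simp
    have "(LBINT y. indicator {0<..<1/2} y * F y) + (LBINT y. indicator {1/2<..<1} y * F y) =
       (LBINT y. indicator {0<..<1/2} y * F y + indicator {1/2<..<1} y * F y)"
      using sub[of "{0<..<1/2}"] sub[of "{1/2<..<1}"]
      by (intro Bochner_Integration.integral_add[symmetric]) (simp_all add: set_integrable_def subset_iff)
    also have "\<dots> = (LBINT y. indicator {0<..<1} y * F y)"
    proof (rule integral_cong_AE)
      show "AE y in lborel. indicator {0<..<1/2} y * F y + indicator {1/2<..<1} y * F y = indicator {0<..<1} y * F y"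
        using AE_lborel_singleton[of "1/2::real"] by eventually_elim (auto simp: indicator_def)
    qed (auto simp: F_def weight_def)
    finally show ?thesis by (simp add: set_lebesgue_integral_def)
  qed
  also have "(LBINT y:{0<..<1}. F y) = T 1 (1/2)"
    using assms by (simp add: T_def F_def frac_kernel_def)
  finally show ?thesis ..
qed

lemma coeff_A_X: "coeff (A [:0, 1:]) 0 = (2 * s - 1) * T 1 (1/2) - \<gamma> * moment 1"
proof -
  have "A [:0, 1:] = smult (2 * s - 1) (T_poly 1) - [:\<gamma> * moment 1:]"
    using A_times_X_aux[of 1] by (simp add: A_1)
  then have "poly (A [:0, 1:]) (1/2) = (2 * s - 1) * poly (T_poly 1) (1/2) - \<gamma> * moment 1"
    by simp
  moreover have "poly (A [:0, 1:]) (1/2) = coeff (A [:0, 1:]) 0"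
    by (subst A_X) simp
  moreover have "T 1 (1/2) = poly (T_poly 1) (1/2)" by (rule T_eq_poly) simp
  ultimately show ?thesis by simp
qed

text \<open>
  The two cases of \<open>frac_const\<close> agree in this form: for \<open>s = 1/2\<close> the constant \<open>A x\<close> is \<open>- moment 1 = - \<pi>\<close>,
  and otherwise it is \<open>(2 s - 1) T 1 = (2 s - 1) \<pi> / sin (\<pi> s)\<close>.
\<close>
lemma frac_const_times: "frac_const s * - coeff (A [:0, 1:]) 0 = Gamma (2 * s)"
proof (cases "s = 1/2")
  case True
  have "moment 1 = Beta s s"
    using set_borel_integral_eq_integral(2)[OF set_integrable_\<omega>] \<omega>_has_integral
    by (simp add: moment_def integral_unique)
  moreover have "Beta (1/2) (1/2) = (pi :: real)"
    by (simp add: Beta_def Gamma_one_half_real)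
  then have "Beta s s = pi" by (simp only: True)
  ultimately have "moment 1 = pi" by simp
  moreover have "frac_const s = 1 / pi" "log_term s = 1" "2 * s = 1"
    using True by (simp_all add: frac_const_def log_term_def)
  ultimately show ?thesis unfolding coeff_A_X by simp
next
  case False
  have T_val: "T 1 (1/2) = pi / sin (pi * s)"
    using Gamma_reflection_real[of s] False by (simp add: T_1_half Beta_def mult.commute)
  have sin_pos: "sin (pi * s) > 0" using s_pos s_less_1 by (intro sin_gt_zero) auto
  have Gamma_step: "Gamma (2 * s) = (2 * s - 1) * Gamma (2 * s - 1)"
  proof -
    have "2 * s - 1 \<notin> \<int>\<^sub>\<le>\<^sub>0"
    proof
      assume "2 * s - 1 \<in> \<int>\<^sub>\<le>\<^sub>0"
      then obtain k :: nat where "2 * s - 1 = - real k" by (elim nonpos_Ints_cases') simp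
      with s_pos False show False by (cases k) auto
    qed
    then show ?thesis using Gamma_plus1[of "2 * s - 1"] by simp
  qed
  have "frac_const s * - coeff (A [:0, 1:]) 0 =
      (Gamma (2 * s - 1) * sin (pi * s) / pi) * ((2 * s - 1) * (pi / sin (pi * s)))"
    using False by (simp add: frac_const_def coeff_A_X log_term_def T_val)
  also have "\<dots> = (2 * s - 1) * Gamma (2 * s - 1)"
    using sin_pos by simp
  finally show ?thesis by (simp only: Gamma_step)
qed

end

section \<open>The eigenvalue identity\<close>

theorem theorem3p14:
  fixes s :: real and n :: nat and p :: "real \<Rightarrow> real"
  assumes "0 < s" and "s < 1"
  defines "p \<equiv> (\<lambda>x. gegenbauer (s + 1/2) n (2 * x - 1))"
  shows "\<forall>x\<in>{0<..<1}.
           weighted_frac_laplacian_exists s 0 1 p x \<and>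
           weighted_frac_laplacian s 0 1 p x = Gamma (2 * s + real n + 1) / fact n * p x"
proof
  fix x :: real assume x: "x \<in> {0<..<1}"
  interpret fractional_order s by unfold_locales fact+
  define q where "q = gegenbauer_poly n"
  have p: "p = poly q" by (rule ext) (simp add: p_def q_def poly_gegenbauer_poly)
  have integrand: "weighted_integrand s 0 1 p z y = K (z - y) * (\<omega> y * poly (B q) y)"
    if "y \<in> {0<..<1}" for y z
    using weight_poly_deriv[OF that, of q] by (simp add: weighted_integrand_def p DERIV_imp_deriv)
  have potential: "weighted_potential s 0 1 p = T (B q)"
    unfolding weighted_potential_def T_def
    by (intro ext set_lebesgue_integral_cong) (auto simp: integrand)
  have deriv: "(weighted_potential s 0 1 p has_real_derivative poly (A (B q)) x) (at x)"
    unfolding potential by (rule T_has_derivative[OF x])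
  have "weighted_frac_laplacian_exists s 0 1 p x"
    unfolding weighted_frac_laplacian_exists_def
  proof (intro conjI ballI)
    show "(\<lambda>t. weight s 0 1 t * p t) field_differentiable at y" if "y \<in> {0<..<1}" for y
      using weight_poly_deriv[OF that, of q] unfolding p field_differentiable_def by blast
    show "set_integrable lborel {0<..<1} (weighted_integrand s 0 1 p z)" if "z \<in> {0<..<1}" for z
      using T_integrable[OF that, of "B q"]
      by (rule set_integrable_cong[THEN iffD1, rotated -1]) (simp_all add: integrand)
    show "weighted_potential s 0 1 p field_differentiable at x"
      using deriv unfolding field_differentiable_def by blast
  qed
  moreover have "weighted_frac_laplacian s 0 1 p x =
      (frac_const s * - coeff (A [:0, 1:]) 0) * pochhammer (2 * s) (Suc n) / fact n * p x"
    unfolding weighted_frac_laplacian_def DERIV_imp_deriv[OF deriv]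
    by (simp add: q_def A_B_gegenbauer_poly p)
  moreover have "Gamma (2 * s) * pochhammer (2 * s) (Suc n) = Gamma (2 * s + real n + 1)"
  proof -
    have "2 * s \<notin> \<int>\<^sub>\<le>\<^sub>0" using s_pos by (auto elim!: nonpos_Ints_cases')
    moreover have "Gamma (2 * s) \<noteq> 0" using s_pos by (simp add: Gamma_real_pos less_imp_neq[symmetric])
    ultimately show ?thesis by (simp add: pochhammer_Gamma add_ac)
  qed
  ultimately show "weighted_frac_laplacian_exists s 0 1 p x \<and>
           weighted_frac_laplacian s 0 1 p x = Gamma (2 * s + real n + 1) / fact n * p x"
    unfolding frac_const_times by simp
qed

end
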